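(* Let $\Bbbk$ be a field, $R=\Bbbk[x_1,\ldots,x_n]$, $\omega\in(\mathbb{Z}^+)^n$ a weight vector, $I\subset R$ an $\omega$-homogeneous ideal, $d=\dim(R/I)$, and assume that $A=\Bbbk[x_{n-d+1},\ldots,x_n]$ is a Noether normalization of $R/I$. With $\mathcal{B}_0$, $\mathcal{B}_1'$, $\psi_0$, $\mathbf{h}_\alpha$ and the Schreyer-like order $>_{\mathrm{SL}}$ as defined in the context, the set $\mathcal{H}=\{\mathbf{h}_\alpha\mid\mathbf{x}^\alpha\in\mathcal{B}_1'\}$ is the reduced Gröbner basis of the submodule $\ker(\psi_0)\subset\bigoplus_{v\in\mathcal{B}_0}A(-\deg_\omega(v))$ for the order $>_{\mathrm{SL}}$.
   Context: $\Bbbk$ is an arbitrary field and $R=\Bbbk[x_1,\ldots,x_n]$ is graded by $\deg_\omega(x_i)=\omega_i$, where $\omega=(\omega_1,\ldots,\omega_n)\in(\mathbb{Z}^+)^n$; $I\subset R$ is homogeneous for this grading and $d=\dim(R/I)$ is the Krull dimension. "$A=\Bbbk[x_{n-d+1},\ldots,x_n]$ is a Noether normalization of $R/I$" means that the natural map $A\to R/I$ is injective and integral. Monomial order: $>_\omega$ is the $\omega$-graded reverse lexicographic order on $R$: $\mathbf{x}^\alpha>_\omega\mathbf{x}^\beta$ iff $\deg_\omega(\mathbf{x}^\alpha)>\deg_\omega(\mathbf{x}^\beta)$, or these degrees are equal and the last nonzero entry of $\alpha-\beta$ is negative. $\mathrm{in}(f)$ and $\mathrm{in}(I)$ denote the initial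 term and initial ideal for $>_\omega$, and $\mathcal{G}$ is the reduced Gröbner basis of $I$ for $>_\omega$. $\mathcal{B}_0$ is the (finite) set of monomials of $R$ not belonging to $\mathrm{in}(I)+\langle x_{n-d+1},\ldots,x_n\rangle$. Let $\{\boldsymbol\epsilon_v\mid v\in\mathcal{B}_0\}$ be the canonical basis of $\bigoplus_{v\in\mathcal{B}_0}A(-\deg_\omega(v))$; $\psi_0:\bigoplus_{v\in\mathcal{B}_0}A(-\deg_\omega(v))\to R/I$ is the graded $A$-module homomorphism with $\psi_0(\boldsymbol\epsilon_v)=v+I$. Let $\chi:R\to R$ be the $\Bbbk$-algebra morphism with $\chi(x_i)=x_i$ for $1\le i\le n-d$ and $\chi(x_j)=1$ for $n-d+1\le j\le n$, and let $J=\chi(\mathrm{in}(I))\cdot R$ be the ideal generated by $\chi(\mathrm{in}(I))$. For each $u\in\mathcal{B}_0\cap J$, let $I_u=(\mathrm{in}(I):u)\cap A$, a monomial ideal of $A$, and let $G(I_u)$ be its minimal monomial generating set. Set $$\mathcal{B}_1'=\{u\cdot M\mid u\in\mathcal{B}_0\cap J,\ M\in G(I_u)\}.$$ Each $\mathbf{x}^\alpha\in\mathcal{B}_1'$ is written uniquely as $\mathbf{x}^\alpha=u\cdot M_\alpha$ with $u=\chi(\mathbf{x}^\alpha)\in\mathcal{B}_0\cap J$ and $M_\alpha\in G(I_u)$. Let $r_\alpha$ be the remainder of the division of $\mathbf{x}^\alpha$ by $\mathcal{G}$; it can be written uniquely as $r_\alpha=\sum_{v\in\mathcal{B}_0}f_{\alpha,v}v$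 with $f_{\alpha,v}\in A$. Define $$\mathbf{h}_\alpha=M_\alpha\boldsymbol\epsilon_u-\sum_{v\in\mathcal{B}_0}f_{\alpha,v}\boldsymbol\epsilon_v\in\bigoplus_{v\in\mathcal{B}_0}A(-\deg_\omega(v)).$$ The Schreyer-like order $>_{\mathrm{SL}}$ is the monomial order on the free module $\bigoplus_{v\in\mathcal{B}_0}A(-\deg_\omega(v))$ defined, for monomials $M,M'\in A$ and $u,v\in\mathcal{B}_0$, by $$M\boldsymbol\epsilon_u>_{\mathrm{SL}}M'\boldsymbol\epsilon_v\iff u\cdot M>_\omega v\cdot M'.$$ *)

theory Defs
  imports
    "HOL-Algebra.QuotRing"
    "HOL-Algebra.Module"
    "HOL-Library.Poly_Mapping"
    "HOL-Library.Extended_Real"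
begin

section \<open>Polynomial rings\<close>

text \<open>
  A monomial is identified with its exponent vector.  Variables are indexed by all natural
  numbers, and a polynomial ring in a set of variables is cut out by a carrier;
  \<open>k[x\<^sub>1, \<dots>, x\<^sub>n]\<close> is \<open>pring {1..n}\<close>.
\<close>

abbreviation keys :: "('a \<Rightarrow>\<^sub>0 'b::zero) \<Rightarrow> 'a set" where
  "keys \<equiv> Poly_Mapping.keys"

abbreviation lookup :: "('a \<Rightarrow>\<^sub>0 'b::zero) \<Rightarrow> 'a \<Rightarrow> 'b" where
  "lookup \<equiv> Poly_Mapping.lookup"

type_synonym mon = "nat \<Rightarrow>\<^sub>0 nat"
type_synonym 'k mpol = "mon \<Rightarrow>\<^sub>0 'k"

definition mons :: "nat set \<Rightarrow> mon set" where
  "mons V = {m. keys m \<subseteq> V}"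

definition pring :: "nat set \<Rightarrow> ('k::field) mpol ring" where
  "pring V = \<lparr>carrier = {p. keys p \<subseteq> mons V}, mult = (*), one = 1, zero = 0, add = (+)\<rparr>"

definition xmon :: "mon \<Rightarrow> ('k::field) mpol" where
  "xmon m = Poly_Mapping.single m 1"

definition xvar :: "nat \<Rightarrow> ('k::field) mpol" where
  "xvar i = xmon (Poly_Mapping.single i 1)"

definition poly_subst :: "(nat \<Rightarrow> 'k mpol) \<Rightarrow> ('k::field) mpol \<Rightarrow> 'k mpol" where
  "poly_subst \<phi> f =
     (\<Sum>m\<in>keys f. Poly_Mapping.single 0 (lookup f m) * (\<Prod>i\<in>keys m. \<phi> i ^ lookup m i))"

definition mon_dvd :: "mon \<Rightarrow> mon \<Rightarrow> bool" where
  "mon_dvd m m' \<longleftrightarrow> (\<exists>c. m' = m + c)"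

definition wdeg :: "(nat \<Rightarrow> nat) \<Rightarrow> mon \<Rightarrow> nat" where
  "wdeg w m = (\<Sum>i\<in>keys m. w i * lookup m i)"

definition hom_component :: "(nat \<Rightarrow> nat) \<Rightarrow> nat \<Rightarrow> ('k::field) mpol \<Rightarrow> 'k mpol" where
  "hom_component w e f = (\<Sum>m\<in>{m \<in> keys f. wdeg w m = e}. Poly_Mapping.single m (lookup f m))"

definition homogeneous_set :: "(nat \<Rightarrow> nat) \<Rightarrow> ('k::field) mpol set \<Rightarrow> bool" where
  "homogeneous_set w K \<longleftrightarrow> (\<forall>f\<in>K. \<forall>e. hom_component w e f \<in> K)"


section \<open>Krull dimension and Noether normalization\<close>

text \<open>
  The supremum of the lengths \<open>k\<close> of strict chains \<open>P 0 \<subset> \<dots> \<subset> P k\<close> of prime ideals;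
  the zero ring has dimension \<open>-\<infinity>\<close>.
\<close>

definition krull_dim :: "('a, 'b) ring_scheme \<Rightarrow> ereal" where
  "krull_dim S =
     (SUP k \<in> {k. \<exists>P. (\<forall>i\<le>k. primeideal (P i) S) \<and> (\<forall>i<k. P i \<subset> P (Suc i))}.
        ereal (real k))"

definition integral_elem :: "('a, 'b) ring_scheme \<Rightarrow> 'a set \<Rightarrow> 'a \<Rightarrow> bool" where
  "integral_elem S K y \<longleftrightarrow>
     (\<exists>m c. (\<forall>i<m. c i \<in> K) \<and>
        y [^]\<^bsub>S\<^esub> (m::nat) \<oplus>\<^bsub>S\<^esub> (\<Oplus>\<^bsub>S\<^esub>i\<in>{..<m}. c i \<otimes>\<^bsub>S\<^esub> y [^]\<^bsub>S\<^esub> i) = \<zero>\<^bsub>S\<^esub>)"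

definition is_noether_normalization ::
  "('a, 'b) ring_scheme \<Rightarrow> 'a set \<Rightarrow> ('a, 'c) ring_scheme \<Rightarrow> bool" where
  "is_noether_normalization R I A \<longleftrightarrow>
     inj_on (\<lambda>a. I +>\<^bsub>R\<^esub> a) (carrier A) \<and>
     (\<forall>y\<in>carrier (R Quot I). integral_elem (R Quot I) ((\<lambda>a. I +>\<^bsub>R\<^esub> a) ` carrier A) y)"


section \<open>Groebner bases of ideals\<close>

definition wrevlex :: "(nat \<Rightarrow> nat) \<Rightarrow> mon \<Rightarrow> mon \<Rightarrow> bool" where
  "wrevlex w \<alpha> \<beta> \<longleftrightarrow>
     wdeg w \<alpha> > wdeg w \<beta> \<or>
     wdeg w \<alpha> = wdeg w \<beta> \<and>
       (\<exists>k. lookup \<alpha> k < lookup \<beta> k \<and> (\<forall>j>k. lookup \<alpha> j = lookup \<beta> j))"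

definition greatest_by :: "('m \<Rightarrow> 'm \<Rightarrow> bool) \<Rightarrow> 'm set \<Rightarrow> 'm" where
  "greatest_by gt S = (THE m. m \<in> S \<and> (\<forall>m'\<in>S. m' \<noteq> m \<longrightarrow> gt m m'))"

definition lmon :: "(nat \<Rightarrow> nat) \<Rightarrow> ('k::field) mpol \<Rightarrow> mon" where
  "lmon w f = greatest_by (wrevlex w) (keys f)"

definition lcoeff :: "(nat \<Rightarrow> nat) \<Rightarrow> ('k::field) mpol \<Rightarrow> 'k" where
  "lcoeff w f = lookup f (lmon w f)"

text \<open>The initial term; it is \<open>0\<close> for \<open>f = 0\<close>.\<close>

definition init_term :: "(nat \<Rightarrow> nat) \<Rightarrow> ('k::field) mpol \<Rightarrow> 'k mpol" where
  "init_term w f = Poly_Mapping.single (lmon w f) (lcoeff w f)"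

definition init_ideal :: "nat \<Rightarrow> (nat \<Rightarrow> nat) \<Rightarrow> ('k::field) mpol set \<Rightarrow> 'k mpol set" where
  "init_ideal n w I = Idl\<^bsub>pring {1..n}\<^esub> (init_term w ` I)"

definition is_reduced_gb ::
  "nat \<Rightarrow> (nat \<Rightarrow> nat) \<Rightarrow> ('k::field) mpol set \<Rightarrow> 'k mpol set \<Rightarrow> bool" where
  "is_reduced_gb n w I G \<longleftrightarrow>
     finite G \<and> G \<subseteq> I \<and>
     Idl\<^bsub>pring {1..n}\<^esub> (init_term w ` G) = init_ideal n w I \<and>
     (\<forall>g\<in>G. lcoeff w g = 1) \<and>
     (\<forall>g\<in>G. \<forall>m\<in>keys g. xmon m \<notin> Idl\<^bsub>pring {1..n}\<^esub> (init_term w ` (G - {g})))"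

definition reduced_gb :: "nat \<Rightarrow> (nat \<Rightarrow> nat) \<Rightarrow> ('k::field) mpol set \<Rightarrow> 'k mpol set" where
  "reduced_gb n w I = (THE G. is_reduced_gb n w I G)"

definition is_remainder ::
  "nat \<Rightarrow> (nat \<Rightarrow> nat) \<Rightarrow> ('k::field) mpol set \<Rightarrow> 'k mpol \<Rightarrow> 'k mpol \<Rightarrow> bool" where
  "is_remainder n w G f r \<longleftrightarrow>
     r \<in> carrier (pring {1..n}) \<and>
     (\<exists>q. (\<forall>g\<in>G. q g \<in> carrier (pring {1..n})) \<and>
          f = (\<Sum>g\<in>G. q g * g) + r \<and>
          (\<forall>g\<in>G. q g * g \<noteq> 0 \<longrightarrow> f \<noteq> 0 \<and> \<not> wrevlex w (lmon w (q g * g)) (lmon w f))) \<and>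
     (\<forall>m\<in>keys r. \<forall>g\<in>G. \<not> mon_dvd (lmon w g) m)"

text \<open>
  Only used for a Groebner basis \<open>G\<close>, where the remainder does not depend on the choices
  made in the division algorithm.
\<close>

definition remainder ::
  "nat \<Rightarrow> (nat \<Rightarrow> nat) \<Rightarrow> ('k::field) mpol set \<Rightarrow> 'k mpol \<Rightarrow> 'k mpol" where
  "remainder n w G f = (THE r. is_remainder n w G f r)"


section \<open>The free module and its order\<close>

definition tail_vars :: "nat \<Rightarrow> nat \<Rightarrow> nat set" where
  "tail_vars n d = {n - d + 1..n}"

abbreviation noether_ring :: "nat \<Rightarrow> nat \<Rightarrow> ('k::field) mpol ring" where
  "noether_ring n d \<equiv> pring (tail_vars n d)"

definition B0 :: "nat \<Rightarrow> nat \<Rightarrow> (nat \<Rightarrow> nat) \<Rightarrow> ('k::field) mpol set \<Rightarrow> mon set" where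
  "B0 n d w I =
     {m \<in> mons {1..n}.
        xmon m \<notin> init_ideal n w I
                 <+>\<^bsub>pring {1..n}\<^esub> Idl\<^bsub>pring {1..n}\<^esub> (xvar ` tail_vars n d)}"

text \<open>
  An element of the free module sends \<open>v\<close> to its \<open>\<epsilon>\<^sub>v\<close>-coordinate, so \<open>M \<epsilon>\<^sub>u\<close>
  is \<open>single u (xmon M)\<close>.  The module record extends the ring record; its fields
  \<open>mult\<close> and \<open>one\<close> carry no meaning here.
\<close>

type_synonym 'k fmod = "mon \<Rightarrow>\<^sub>0 'k mpol"

definition free_module ::
  "('k::field) mpol ring \<Rightarrow> mon set \<Rightarrow> ('k mpol, 'k fmod) module" where
  "free_module A B =
     \<lparr>carrier = {g. keys g \<subseteq> B \<and> (\<forall>v. lookup g v \<in> carrier A)},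
      mult = (\<lambda>_ _. 0), one = 0, zero = 0, add = (+),
      smult = (\<lambda>a. Poly_Mapping.map ((*) a))\<rparr>"

definition lin_comb :: "('k::field) fmod \<Rightarrow> 'k mpol" where
  "lin_comb g = (\<Sum>v\<in>keys g. lookup g v * xmon v)"

definition F0 ::
  "nat \<Rightarrow> nat \<Rightarrow> (nat \<Rightarrow> nat) \<Rightarrow> ('k::field) mpol set \<Rightarrow> ('k mpol, 'k fmod) module" where
  "F0 n d w I = free_module (noether_ring n d) (B0 n d w I)"

definition psi0 :: "nat \<Rightarrow> ('k::field) mpol set \<Rightarrow> 'k fmod \<Rightarrow> 'k mpol set" where
  "psi0 n I g = I +>\<^bsub>pring {1..n}\<^esub> lin_comb g"

definition ker_psi0 ::
  "nat \<Rightarrow> nat \<Rightarrow> (nat \<Rightarrow> nat) \<Rightarrow> ('k::field) mpol set \<Rightarrow> 'k fmod set" where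
  "ker_psi0 n d w I = a_kernel (F0 n d w I) (pring {1..n} Quot I) (psi0 n I)"

text \<open>The pair \<open>(M, u)\<close> stands for the module monomial \<open>M \<epsilon>\<^sub>u\<close>.\<close>

definition mod_keys :: "('k::field) fmod \<Rightarrow> (mon \<times> mon) set" where
  "mod_keys g = {(M, u). M \<in> keys (lookup g u)}"

definition schreyer_like :: "(nat \<Rightarrow> nat) \<Rightarrow> mon \<times> mon \<Rightarrow> mon \<times> mon \<Rightarrow> bool" where
  "schreyer_like w = (\<lambda>(M, u) (M', v). wrevlex w (u + M) (v + M'))"

definition gen_submodule ::
  "('a, 'c) ring_scheme \<Rightarrow> ('a, 'b, 'd) module_scheme \<Rightarrow> 'b set \<Rightarrow> 'b set" where
  "gen_submodule A F S = \<Inter>{H. submodule H A F \<and> S \<subseteq> H}"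

text \<open>
  The order \<open>gt\<close> only has to be a monomial order on the monomials \<open>(M, u)\<close> of the
  free module at hand.
\<close>

definition mod_lmon :: "(mon \<times> mon \<Rightarrow> mon \<times> mon \<Rightarrow> bool) \<Rightarrow> ('k::field) fmod \<Rightarrow> mon \<times> mon" where
  "mod_lmon gt g = greatest_by gt (mod_keys g)"

definition mod_lcoeff :: "(mon \<times> mon \<Rightarrow> mon \<times> mon \<Rightarrow> bool) \<Rightarrow> ('k::field) fmod \<Rightarrow> 'k" where
  "mod_lcoeff gt g = (case mod_lmon gt g of (M, u) \<Rightarrow> lookup (lookup g u) M)"

definition mod_init_term ::
  "(mon \<times> mon \<Rightarrow> mon \<times> mon \<Rightarrow> bool) \<Rightarrow> ('k::field) fmod \<Rightarrow> 'k fmod" where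
  "mod_init_term gt g =
     (case mod_lmon gt g of
        (M, u) \<Rightarrow> Poly_Mapping.single u (Poly_Mapping.single M (mod_lcoeff gt g)))"

definition is_reduced_mod_gb ::
  "('k::field) mpol ring \<Rightarrow> ('k mpol, 'k fmod) module \<Rightarrow>
   (mon \<times> mon \<Rightarrow> mon \<times> mon \<Rightarrow> bool) \<Rightarrow> 'k fmod set \<Rightarrow> 'k fmod set \<Rightarrow> bool" where
  "is_reduced_mod_gb A F gt N H \<longleftrightarrow>
     finite H \<and> H \<subseteq> N \<and>
     gen_submodule A F (mod_init_term gt ` H) = gen_submodule A F (mod_init_term gt ` N) \<and>
     (\<forall>h\<in>H. mod_lcoeff gt h = 1) \<and>
     (\<forall>h\<in>H. \<forall>(M, u)\<in>mod_keys h.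
        Poly_Mapping.single u (xmon M) \<notin> gen_submodule A F (mod_init_term gt ` (H - {h})))"


section \<open>The elements \<open>h\<^sub>\<alpha>\<close>\<close>

definition chi :: "nat \<Rightarrow> nat \<Rightarrow> ('k::field) mpol \<Rightarrow> 'k mpol" where
  "chi n d = poly_subst (\<lambda>i. if i \<in> tail_vars n d then 1 else xvar i)"

definition J_ideal :: "nat \<Rightarrow> nat \<Rightarrow> (nat \<Rightarrow> nat) \<Rightarrow> ('k::field) mpol set \<Rightarrow> 'k mpol set" where
  "J_ideal n d w I = Idl\<^bsub>pring {1..n}\<^esub> (chi n d ` init_ideal n w I)"

text \<open>The contraction to \<open>A\<close> of the colon ideal \<open>in(I) : u\<close>.\<close>

definition I_u ::
  "nat \<Rightarrow> nat \<Rightarrow> (nat \<Rightarrow> nat) \<Rightarrow> ('k::field) mpol set \<Rightarrow> mon \<Rightarrow> 'k mpol set" where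
  "I_u n d w I u =
     {f \<in> carrier (pring {1..n}). f * xmon u \<in> init_ideal n w I} \<inter> carrier (noether_ring n d)"

definition min_mon_gens :: "nat set \<Rightarrow> ('k::field) mpol set \<Rightarrow> mon set" where
  "min_mon_gens V K =
     (THE S. S \<subseteq> mons V \<and> Idl\<^bsub>pring V\<^esub> (xmon ` S) = K \<and>
        (\<forall>S'. S' \<subset> S \<longrightarrow> Idl\<^bsub>pring V\<^esub> (xmon ` S') \<noteq> K))"

definition G_u ::
  "nat \<Rightarrow> nat \<Rightarrow> (nat \<Rightarrow> nat) \<Rightarrow> ('k::field) mpol set \<Rightarrow> mon \<Rightarrow> mon set" where
  "G_u n d w I u = min_mon_gens (tail_vars n d) (I_u n d w I u)"

definition B1' :: "nat \<Rightarrow> nat \<Rightarrow> (nat \<Rightarrow> nat) \<Rightarrow> ('k::field) mpol set \<Rightarrow> mon set" where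
  "B1' n d w I =
     {u + M | u M. u \<in> B0 n d w I \<and> xmon u \<in> J_ideal n d w I \<and> M \<in> G_u n d w I u}"

definition h_elem ::
  "nat \<Rightarrow> nat \<Rightarrow> (nat \<Rightarrow> nat) \<Rightarrow> ('k::field) mpol set \<Rightarrow> mon \<Rightarrow> 'k fmod" where
  "h_elem n d w I \<alpha> =
     (let u = (THE u. (xmon u :: 'k mpol) = chi n d (xmon \<alpha>));
          M = (THE M. M \<in> G_u n d w I u \<and> \<alpha> = u + M);
          r = remainder n w (reduced_gb n w I) (xmon \<alpha>);
          f = (THE f. f \<in> carrier (F0 n d w I) \<and> lin_comb f = r)
      in Poly_Mapping.single u (xmon M) - f)"

end

theory Submission
  imports Defs
begin

text \<open>
  Let \<open>L\<close> be the set of initial monomials of \<open>I\<close>.  Then \<open>B\<^sub>0\<close> consists of the monomials outside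
  \<open>L\<close> in the variables not belonging to \<open>A\<close>, so the map \<open>M \<epsilon>\<^sub>v \<mapsto> v M\<close> is injective on monomials,
  and the Schreyer-like order is the pullback of \<open>>\<^sub>\<omega>\<close> along it.  Hence the initial term of an
  element of \<open>ker \<psi>\<^sub>0\<close> is \<open>M \<epsilon>\<^sub>u\<close>, where \<open>u M\<close> is the initial monomial of its image in \<open>I\<close>; so
  \<open>M\<close> lies in \<open>I\<^sub>u\<close> and is divisible by some \<open>M\<^sub>\<alpha> \<in> G(I\<^sub>u)\<close>.  Conversely \<open>h\<^sub>\<alpha>\<close> is the preimage of
  \<open>x\<^sup>\<alpha> - r\<^sub>\<alpha> \<in> I\<close>, and no monomial of \<open>r\<^sub>\<alpha>\<close> lies in \<open>L\<close>.  Integrality over \<open>A\<close> only serves to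
  make \<open>B\<^sub>0\<close> finite.
\<close>

section \<open>Monomials and Dickson's lemma\<close>

text \<open>The definitions pick \<open>reduced_gb\<close>, \<open>remainder\<close>,
  \<open>min_mon_gens\<close> and the ingredients of \<open>h_elem\<close> by definite description,
  so existence and uniqueness of each must be settled before \<open>h_elem\<close> can be computed.
  The link is the normal form of f: the only polynomial congruent to f modulo I with no monomial in
  \<open>L\<close>. Subtracting the normal form of a monomial s in \<open>L\<close> from s gives a
  monic element of I in which s is the only monomial from \<open>L\<close>. For minimal s these
  elements form the reduced Groebner basis of I. An exponent in \<open>B1'\<close> is minimal only
  among the multiples of its fixed u by monomials of A and need not be minimal in \<open>L\<close>,
  so the construction is carried out for every s in \<open>L\<close>. That s is the only monomial
  from \<open>L\<close> also gives reducedness of the module basis: divisibility by the initial term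
  of another basis element would put a monomial into \<open>L\<close>, and for the leading one it is
  excluded by minimality in G(I_u).\<close>

lemma keys_add_mon [simp]: "keys (a + b :: mon) = keys a \<union> keys b"
  by (auto simp: in_keys_iff lookup_add)

lemma mons_add_iff [simp]: "a + b \<in> mons V \<longleftrightarrow> a \<in> mons V \<and> b \<in> mons V"
  by (auto simp: mons_def)

lemma zero_in_mons [simp]: "0 \<in> mons V"
  by (simp add: mons_def)

lemma mons_mono: "V \<subseteq> W \<Longrightarrow> mons V \<subseteq> mons W"
  by (auto simp: mons_def)

lemma mon_dvd_iff: "mon_dvd a b \<longleftrightarrow> (\<forall>i. lookup a i \<le> lookup b i)"
proof
  show "mon_dvd a b \<Longrightarrow> \<forall>i. lookup a i \<le> lookup b i"
    by (auto simp: mon_dvd_def lookup_add)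
next
  assume *: "\<forall>i. lookup a i \<le> lookup b i"
  have "b = a + (b - a)"
    by (rule poly_mapping_eqI) (use * in \<open>simp add: lookup_add lookup_minus\<close>)
  then show "mon_dvd a b"
    unfolding mon_dvd_def by blast
qed

lemma mon_dvd_refl [simp]: "mon_dvd a a"
  by (simp add: mon_dvd_iff)

lemma mon_dvd_trans: "mon_dvd a b \<Longrightarrow> mon_dvd b c \<Longrightarrow> mon_dvd a c"
  unfolding mon_dvd_iff by (meson le_trans)

lemma mon_dvd_add [simp]: "mon_dvd a (a + b)" "mon_dvd a (b + a)"
  by (simp_all add: mon_dvd_iff lookup_add)

lemma wdeg_eq_sum:
  assumes "finite S" "keys m \<subseteq> S"
  shows "wdeg w m = (\<Sum>i\<in>S. w i * lookup m i)"
  unfolding wdeg_def using assms by (intro sum.mono_neutral_left) (auto simp: in_keys_iff)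

lemma wdeg_add: "wdeg w (a + b) = wdeg w a + wdeg w b"
proof -
  have "wdeg w m = (\<Sum>i\<in>keys a \<union> keys b. w i * lookup m i)" if "keys m \<subseteq> keys a \<union> keys b" for m
    using that by (intro wdeg_eq_sum) auto
  then show ?thesis
    by (simp add: lookup_add distrib_left sum.distrib)
qed

lemma wdeg_zero [simp]: "wdeg w 0 = 0"
  by (simp add: wdeg_def)

lemma wdeg_eq_0_iff:
  assumes "m \<in> mons V" "\<forall>i\<in>V. 0 < w i"
  shows "wdeg w m = 0 \<longleftrightarrow> m = 0"
proof
  assume "wdeg w m = 0"
  then have "\<forall>i\<in>keys m. w i * lookup m i = 0"
    by (simp add: wdeg_def)
  moreover have "w i * lookup m i \<noteq> 0" if "i \<in> keys m" for i
  proof -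
    have "i \<in> V"
      using that assms(1) by (auto simp: mons_def)
    then show ?thesis
      using that bspec[OF assms(2)] by (simp add: in_keys_iff)
  qed
  ultimately have "keys m = {}"
    by blast
  then show "m = 0"
    by simp
qed (simp add: wdeg_def)

text \<open>For the exponents of a monomial ideal these are its minimal monomial generators. The
  definition is applied to \<open>L\<close> and to the exponents of each I_u.\<close>

definition min_elems :: "mon set \<Rightarrow> mon set" where
  "min_elems S = {s \<in> S. \<forall>t\<in>S. mon_dvd t s \<longrightarrow> t = s}"

lemma min_elems_subset: "min_elems S \<subseteq> S"
  by (auto simp: min_elems_def)

text \<open>Descent on the total degree terminates: with every weight equal to 1, a proper divisor
  has strictly smaller degree, whatever variables occur.\<close>

lemma ex_min_elem_dvd:
  assumes "m \<in> S"
  shows "\<exists>s\<in>min_elems S. mon_dvd s m"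
  using assms
proof (induction "wdeg (\<lambda>_. 1) m" arbitrary: m rule: less_induct)
  case less
  show ?case
  proof (cases "m \<in> min_elems S")
    case True
    then show ?thesis by (intro bexI[of _ m]) simp_all
  next
    case False
    then obtain t where t: "t \<in> S" "mon_dvd t m" "t \<noteq> m"
      using less.prems by (auto simp: min_elems_def)
    then obtain c where c: "m = t + c"
      by (auto simp: mon_dvd_def)
    with t have "c \<noteq> 0" by auto
    then have "wdeg (\<lambda>_. 1) c \<noteq> 0"
      by (simp add: wdeg_eq_0_iff[where V = UNIV] mons_def)
    then have "wdeg (\<lambda>_. 1) t < wdeg (\<lambda>_. 1) m"
      by (simp add: c wdeg_add)
    with less.hyps t show ?thesis
      by (meson mon_dvd_trans)
  qed
qed

text \<open>Every sequence has a monotone subsequence. If it decreases, it is constant from the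
  point where it attains its least value, and this tail is also increasing.\<close>

lemma incseq_subseq_nat: "\<exists>r :: nat \<Rightarrow> nat. strict_mono r \<and> incseq (\<lambda>k. g (r k) :: nat)"
proof -
  obtain f :: "nat \<Rightarrow> nat" where f: "strict_mono f" "monoseq (\<lambda>k. g (f k))"
    using seq_monosub by blast
  show ?thesis
  proof (cases "incseq (\<lambda>k. g (f k))")
    case True
    then show ?thesis using f by blast
  next
    case False
    then have dec: "decseq (\<lambda>k. g (f k))"
      using f by (auto simp: monoseq_iff)
    define a where "a = (LEAST x. x \<in> range (\<lambda>k. g (f k)))"
    have "a \<in> range (\<lambda>k. g (f k))"
      unfolding a_def by (rule LeastI) auto
    then obtain N where N: "a = g (f N)" by auto
    have le: "a \<le> g (f k)" for k
      unfolding a_def by (rule Least_le) auto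
    have "g (f (k + N)) = a" for k
      using le[of "k + N"] decseqD[OF dec, of N "k + N"] N by simp
    moreover have "strict_mono (\<lambda>k. f (k + N))"
      using f(1) by (auto simp: strict_mono_def)
    ultimately show ?thesis
      by (intro exI[of _ "\<lambda>k. f (k + N)"]) (simp add: incseq_def)
  qed
qed

text \<open>Passing to a further subsequence keeps the coordinates already treated increasing, so
  one coordinate can be added at a time.\<close>

lemma incseq_subseq_coordinates:
  fixes f :: "nat \<Rightarrow> 'a \<Rightarrow> nat"
  assumes "finite V"
  shows "\<exists>r :: nat \<Rightarrow> nat. strict_mono r \<and> (\<forall>i\<in>V. incseq (\<lambda>k. f (r k) i))"
  using assms
proof (induction V)
  case empty
  show ?case using strict_mono_id by auto
next
  case (insert x V)
  then obtain r :: "nat \<Rightarrow> nat" where r: "strict_mono r" "\<forall>i\<in>V. incseq (\<lambda>k. f (r k) i)"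
    by auto
  obtain r' :: "nat \<Rightarrow> nat" where r': "strict_mono r'" "incseq (\<lambda>k. f (r (r' k)) x)"
    using incseq_subseq_nat[of "\<lambda>k. f (r k) x"] by auto
  have "incseq (\<lambda>k. f (r (r' k)) i)" if "i \<in> V" for i
    using r(2) that r'(1) by (auto simp: incseq_def strict_mono_less_eq)
  moreover have "strict_mono (\<lambda>k. r (r' k))"
    using r(1) r'(1) by (auto simp: strict_mono_def)
  ultimately show ?case
    using r'(2) by (intro exI[of _ "\<lambda>k. r (r' k)"]) auto
qed

text \<open>Dickson's lemma: a sequence of distinct minimal elements would have a subsequence
  increasing in every variable of \<open>V\<close>, so its first term would divide its second,
  against minimality.\<close>

lemma finite_min_elems:
  assumes "finite V" "S \<subseteq> mons V"
  shows "finite (min_elems S)"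
proof (rule ccontr)
  assume "infinite (min_elems S)"
  then obtain s :: "nat \<Rightarrow> mon" where s: "inj s" "range s \<subseteq> min_elems S"
    using infinite_countable_subset by blast
  obtain r :: "nat \<Rightarrow> nat" where r: "strict_mono r" "\<forall>i\<in>V. incseq (\<lambda>k. lookup (s (r k)) i)"
    using incseq_subseq_coordinates[OF assms(1), of "\<lambda>k. lookup (s k)"] by auto
  have mem: "s k \<in> S" "s k \<in> mons V" "s k \<in> min_elems S" for k
    using s(2) assms(2) by (auto simp: min_elems_def)
  have "lookup (s (r 0)) i \<le> lookup (s (r 1)) i" for i
  proof (cases "i \<in> V")
    case True
    then show ?thesis using r(2) by (auto simp: incseq_def)
  next
    case False
    then have "lookup (s (r 0)) i = 0"
      using mem(2)[of "r 0"] by (auto simp: mons_def in_keys_iff)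
    then show ?thesis by simp
  qed
  then have "mon_dvd (s (r 0)) (s (r 1))"
    by (simp add: mon_dvd_iff)
  then have "s (r 0) = s (r 1)"
    using mem[of "r 0"] mem(3)[of "r 1"] by (auto simp: min_elems_def)
  then have "r 0 = r 1"
    using s(1) by (simp add: inj_eq)
  then show False
    using r(1) by (simp add: strict_mono_eq)
qed

section \<open>Weighted reverse lexicographic order\<close>

lemma wrevlex_irrefl [simp]: "\<not> wrevlex w a a"
  by (simp add: wrevlex_def)

lemma wrevlex_trans:
  assumes "wrevlex w a b" "wrevlex w b c"
  shows "wrevlex w a c"
proof (cases "wdeg w a = wdeg w b \<and> wdeg w b = wdeg w c")
  case True
  then obtain k l where k: "lookup a k < lookup b k" "\<forall>j>k. lookup a j = lookup b j"
    and l: "lookup b l < lookup c l" "\<forall>j>l. lookup b j = lookup c j"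
    using assms by (auto simp: wrevlex_def)
  \<comment> \<open>At the larger of the two deciding indices both comparisons hold weakly and one
    of them strictly. Beyond it \<open>a\<close>, \<open>b\<close> and \<open>c\<close>
    agree.\<close>
  have "lookup a (max k l) \<le> lookup b (max k l)" "lookup b (max k l) \<le> lookup c (max k l)"
    using k l by (metis less_imp_le max.cobounded1 max.cobounded2 order_le_less order_refl)+
  moreover have "max k l = k \<or> max k l = l"
    by linarith
  ultimately have "lookup a (max k l) < lookup c (max k l)"
    using k(1) l(1) by (metis le_less_trans less_le_trans)
  moreover have "\<forall>j>max k l. lookup a j = lookup c j"
    using k(2) l(2) by simp
  ultimately have "\<exists>i. lookup a i < lookup c i \<and> (\<forall>j>i. lookup a j = lookup c j)"
    by (intro exI[of _ "max k l"] conjI)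
  then show ?thesis
    using True by (simp add: wrevlex_def)
next
  case False
  moreover have "wdeg w b \<le> wdeg w a" "wdeg w c \<le> wdeg w b"
    using assms by (auto simp: wrevlex_def)
  ultimately have "wdeg w c < wdeg w a"
    by linarith
  then show ?thesis
    by (simp add: wrevlex_def)
qed

lemma wrevlex_total:
  assumes "a \<noteq> b"
  shows "wrevlex w a b \<or> wrevlex w b a"
proof -
  define D where "D = {i. lookup a i \<noteq> lookup b i}"
  have "D \<subseteq> keys a \<union> keys b"
    by (auto simp: D_def in_keys_iff)
  then have fin: "finite D"
    by (rule finite_subset) simp
  have "D \<noteq> {}"
    using assms poly_mapping_eqI[of a b] by (auto simp: D_def)
  then have "Max D \<in> D"
    using fin by (rule Max_in[rotated])
  then have "lookup a (Max D) \<noteq> lookup b (Max D)"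
    by (simp add: D_def)
  moreover have "lookup a j = lookup b j" if "j > Max D" for j
    using Max_ge[OF fin, of j] that by (force simp: D_def)
  ultimately have
    "(\<exists>k. lookup a k < lookup b k \<and> (\<forall>j>k. lookup a j = lookup b j)) \<or>
     (\<exists>k. lookup b k < lookup a k \<and> (\<forall>j>k. lookup b j = lookup a j))"
    by (metis linorder_neq_iff)
  then show ?thesis
    unfolding wrevlex_def by (metis linorder_neq_iff)
qed

lemma wrevlex_add_iff [simp]: "wrevlex w (a + c) (b + c) \<longleftrightarrow> wrevlex w a b"
  by (simp add: wrevlex_def wdeg_add lookup_add)

lemma wrevlex_asym: "wrevlex w a b \<Longrightarrow> \<not> wrevlex w b a"
  using wrevlex_trans[of w a b a] by auto

text \<open>Weak comparison as the negation of the reversed strict one makes compatibility with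
  products immediate; totality recovers the usual form in \<open>wle_iff\<close>.\<close>

definition wle :: "(nat \<Rightarrow> nat) \<Rightarrow> mon \<Rightarrow> mon \<Rightarrow> bool" where
  "wle w a b \<longleftrightarrow> \<not> wrevlex w a b"

lemma wle_iff: "wle w a b \<longleftrightarrow> a = b \<or> wrevlex w b a"
  unfolding wle_def using wrevlex_total[of a b w] wrevlex_asym[of w a b] by auto

lemma wle_refl [simp]: "wle w a a"
  by (simp add: wle_def)

lemma wle_trans: "wle w a b \<Longrightarrow> wle w b c \<Longrightarrow> wle w a c"
  unfolding wle_iff using wrevlex_trans[of w c b a] by auto

lemma wle_antisym: "wle w a b \<Longrightarrow> wle w b a \<Longrightarrow> a = b"
  unfolding wle_iff using wrevlex_asym[of w a b] by auto

lemma wle_add_iff [simp]: "wle w (a + c) (b + c) \<longleftrightarrow> wle w a b"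
  by (simp add: wle_def)

section \<open>Greatest elements and leading monomials\<close>

lemma ex_greatest_wrevlex:
  assumes "finite S" "S \<noteq> {}"
  shows "\<exists>m\<in>S. \<forall>m'\<in>S. m' \<noteq> m \<longrightarrow> wrevlex w m m'"
  using assms
proof (induction S rule: finite_ne_induct)
  case (insert x S)
  then obtain m where m: "m \<in> S" "\<forall>m'\<in>S. m' \<noteq> m \<longrightarrow> wrevlex w m m'"
    by blast
  with insert.hyps have "x \<noteq> m" by auto
  with wrevlex_total consider "wrevlex w x m" | "wrevlex w m x"
    by blast
  then show ?case
  proof cases
    case 1
    then have "wrevlex w x m'" if "m' \<in> S" for m'
      using m(2) that wrevlex_trans[of w x m m'] by (cases "m' = m") simp_all
    then show ?thesis by blast
  next
    case 2
    with m show ?thesis by blast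
  qed
qed auto

text \<open>Serves both \<open>wrevlex\<close> and \<open>schreyer_like\<close>. Asymmetry at
  \<open>m\<close> excludes a second greatest element, which makes the description in
  \<open>greatest_by\<close> definite.\<close>

lemma greatest_by_eqI:
  assumes "m \<in> S" "\<And>m'. m' \<in> S \<Longrightarrow> m' \<noteq> m \<Longrightarrow> gt m m'" "\<And>m'. m' \<in> S \<Longrightarrow> gt m m' \<Longrightarrow> \<not> gt m' m"
  shows "greatest_by gt S = m"
  unfolding greatest_by_def
proof (rule the_equality)
  show "m \<in> S \<and> (\<forall>m'\<in>S. m' \<noteq> m \<longrightarrow> gt m m')"
    using assms(1,2) by blast
  fix x assume x: "x \<in> S \<and> (\<forall>m'\<in>S. m' \<noteq> x \<longrightarrow> gt x m')"
  show "x = m"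
  proof (rule ccontr)
    assume "x \<noteq> m"
    then have "gt m x" "gt x m"
      using x assms(1,2) by auto
    then show False
      using assms(3) x by blast
  qed
qed

lemma lmon_eqI:
  assumes "m \<in> keys f" "\<And>m'. m' \<in> keys f \<Longrightarrow> wle w m' m"
  shows "lmon w f = m"
  unfolding lmon_def
proof (rule greatest_by_eqI[OF assms(1)])
  show "wrevlex w m m'" if "m' \<in> keys f" "m' \<noteq> m" for m'
    using assms(2)[OF that(1)] that(2) by (simp add: wle_iff)
qed (rule wrevlex_asym)

lemma
  assumes "f \<noteq> 0"
  shows lmon_in_keys: "lmon w f \<in> keys f"
    and wle_lmon: "m \<in> keys f \<Longrightarrow> wle w m (lmon w f)"
proof -
  obtain m0 where m0: "m0 \<in> keys f" "\<forall>m'\<in>keys f. m' \<noteq> m0 \<longrightarrow> wrevlex w m0 m'"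
    using ex_greatest_wrevlex[of "keys f" w] assms by auto
  then have "lmon w f = m0"
    by (intro lmon_eqI) (auto simp: wle_iff)
  then show "lmon w f \<in> keys f" "m \<in> keys f \<Longrightarrow> wle w m (lmon w f)"
    using m0 by (auto simp: wle_iff)
qed

lemma lcoeff_eq_0_iff [simp]: "lcoeff w f = 0 \<longleftrightarrow> f = 0"
  using lmon_in_keys[of f w] by (auto simp: lcoeff_def in_keys_iff)

text \<open>On all of \<open>mon\<close> the order is not well-founded: with infinitely many
  variables of equal weight, or with one variable of weight 0, there are infinite descending chains.
  A finite set of variables with positive weights excludes both.\<close>

locale weights =
  fixes V :: "nat set" and w :: "nat \<Rightarrow> nat"
  assumes finite_vars: "finite V"
    and weight_pos: "\<forall>i\<in>V. 0 < w i"
begin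

lemma mon_dvd_imp_wle:
  assumes "mon_dvd a b" "b \<in> mons V"
  shows "wle w a b"
proof -
  obtain c where c: "b = a + c"
    using assms(1) by (auto simp: mon_dvd_def)
  with assms(2) have "c \<in> mons V" by simp
  then have "c = 0 \<or> 0 < wdeg w c"
    using wdeg_eq_0_iff weight_pos by blast
  then show ?thesis
    by (auto simp: c wle_iff wrevlex_def wdeg_add)
qed

text \<open>A positive integer weight makes the degree an upper bound for each single
  exponent.\<close>

lemma finite_wdeg_le: "finite {m \<in> mons V. wdeg w m \<le> e}"
proof -
  let ?F = "{f. \<forall>i. (i \<in> V \<longrightarrow> f i \<in> {..e}) \<and> (i \<notin> V \<longrightarrow> f i = (0 :: nat))}"
  have "lookup m \<in> ?F" if m: "m \<in> mons V" "wdeg w m \<le> e" for m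
  proof -
    have "lookup m i \<le> e" if "i \<in> V" for i
    proof -
      have "w i * lookup m i \<le> (\<Sum>i\<in>V. w i * lookup m i)"
        using that finite_vars by (intro member_le_sum) auto
      also have "\<dots> \<le> e"
        using m wdeg_eq_sum[OF finite_vars, of m w] by (simp add: mons_def)
      finally have "w i * lookup m i \<le> e" .
      moreover have "lookup m i \<le> w i * lookup m i"
        using bspec[OF weight_pos that] by (cases "w i") auto
      ultimately show ?thesis by linarith
    qed
    then show ?thesis
      using m by (auto simp: mons_def in_keys_iff)
  qed
  then have "lookup ` {m \<in> mons V. wdeg w m \<le> e} \<subseteq> ?F"
    by (intro image_subsetI) simp
  moreover have "finite ?F"
    using finite_vars by (intro finite_set_of_finite_funs) auto
  ultimately have "finite (lookup ` {m \<in> mons V. wdeg w m \<le> e})"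
    by (rule finite_subset)
  then show ?thesis
    by (rule finite_imageD) (auto intro: inj_onI poly_mapping_eqI)
qed

text \<open>Everything below \<open>b\<close> has degree at most that of \<open>b\<close>, so only
  finitely many monomials lie below it. Their number is the measure of the induction.\<close>

lemma mons_wrevlex_induct [consumes 1, case_names less]:
  assumes "b \<in> mons V"
    and step: "\<And>b. b \<in> mons V \<Longrightarrow> (\<And>c. c \<in> mons V \<Longrightarrow> wrevlex w b c \<Longrightarrow> P c) \<Longrightarrow> P b"
  shows "P b"
  using assms(1)
proof (induction "card {c \<in> mons V. wrevlex w b c}" arbitrary: b rule: less_induct)
  case less
  have fin: "finite {c \<in> mons V. wrevlex w b c}" for b
    by (rule finite_subset[OF _ finite_wdeg_le[of "wdeg w b"]]) (auto simp: wrevlex_def)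
  show ?case
  proof (rule step[OF less.prems])
    fix c assume c: "c \<in> mons V" "wrevlex w b c"
    have "c \<in> {x \<in> mons V. wrevlex w b x} - {x \<in> mons V. wrevlex w c x}"
      using c by simp
    moreover have "{x \<in> mons V. wrevlex w c x} \<subseteq> {x \<in> mons V. wrevlex w b x}"
      using wrevlex_trans[OF c(2)] by auto
    ultimately have "{x \<in> mons V. wrevlex w c x} \<subset> {x \<in> mons V. wrevlex w b x}"
      by blast
    then show "P c"
      using less.hyps[of c] psubset_card_mono[OF fin] c(1) by blast
  qed
qed

end

section \<open>Polynomial rings and monomial ideals\<close>

lemma keys_xmon [simp]: "keys (xmon m :: 'k::field mpol) = {m}"
  by (simp add: xmon_def)

lemma lookup_xmon: "lookup (xmon m :: 'k::field mpol) m' = (if m = m' then 1 else 0)"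
  by (simp add: xmon_def lookup_single when_def)

lemma xmon_eq_iff [simp]: "(xmon m :: 'k::field mpol) = xmon m' \<longleftrightarrow> m = m'"
  by (metis keys_xmon singleton_inject)

lemma xmon_add: "(xmon (a + b) :: 'k::field mpol) = xmon a * xmon b"
  by (simp add: xmon_def mult_single)

lemma keys_uminus [simp]: "keys (- p :: 'a \<Rightarrow>\<^sub>0 'b::ab_group_add) = keys p"
  by (auto simp: in_keys_iff)

lemma keys_minus_subset: "keys (p - q :: 'a \<Rightarrow>\<^sub>0 'b::ab_group_add) \<subseteq> keys p \<union> keys q"
  by (auto simp: in_keys_iff lookup_minus)

lemma keys_sum_subset: "keys (\<Sum>i\<in>S. f i :: 'a \<Rightarrow>\<^sub>0 'b::comm_monoid_add) \<subseteq> (\<Union>i\<in>S. keys (f i))"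
proof
  fix k assume "k \<in> keys (\<Sum>i\<in>S. f i)"
  then have "(\<Sum>i\<in>S. lookup (f i) k) \<noteq> 0"
    by (simp add: in_keys_iff lookup_sum)
  then obtain i where "i \<in> S" "lookup (f i) k \<noteq> 0"
    using sum.not_neutral_contains_not_neutral by blast
  then show "k \<in> (\<Union>i\<in>S. keys (f i))"
    by (auto simp: in_keys_iff)
qed

lemma sum_single_lookup: "(\<Sum>k\<in>keys p. Poly_Mapping.single k (lookup p k)) = p"
proof (rule poly_mapping_eqI)
  fix k
  have "lookup (\<Sum>k\<in>keys p. Poly_Mapping.single k (lookup p k)) k
      = (\<Sum>i\<in>keys p. if i = k then lookup p i else 0)"
    by (simp add: lookup_sum lookup_single when_def)
  also have "\<dots> = lookup p k"
    by (simp add: sum.delta' in_keys_iff)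
  finally show "lookup (\<Sum>k\<in>keys p. Poly_Mapping.single k (lookup p k)) k = lookup p k" .
qed

lemma lookup_mult_single [simp]:
  fixes p :: "'k::field mpol"
  shows "lookup (p * Poly_Mapping.single s c) (m + s) = lookup p m * c"
proof -
  \<comment> \<open>In the convolution the second exponent must be \<open>s\<close>, and cancelling
    it from \<open>m + s = l + q\<close> leaves the single summand \<open>l = m\<close>.\<close>
  have inner: "(\<Sum>q. lookup (Poly_Mapping.single s c) q when m + s = l + q) = (c when m = l)" for l
  proof -
    have "(\<lambda>q. lookup (Poly_Mapping.single s c) q when m + s = l + q) = (\<lambda>q. (c when m = l) when s = q)"
      by (auto simp: lookup_single when_def fun_eq_iff)
    then show ?thesis
      by (simp only: Sum_any_when_equal')
  qed
  have "lookup (p * Poly_Mapping.single s c) (m + s) = (\<Sum>l. lookup p l * c when m = l)"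
    by (simp add: lookup_mult inner mult_when)
  then show ?thesis by simp
qed

lemma keys_mult_single:
  fixes p :: "'k::field mpol"
  assumes "c \<noteq> 0"
  shows "keys (p * Poly_Mapping.single s c) = (\<lambda>m. m + s) ` keys p"
proof
  show "keys (p * Poly_Mapping.single s c) \<subseteq> (\<lambda>m. m + s) ` keys p"
    using keys_mult[of p "Poly_Mapping.single s c"] assms by auto
  show "(\<lambda>m. m + s) ` keys p \<subseteq> keys (p * Poly_Mapping.single s c)"
    using assms by (auto simp: in_keys_iff)
qed

lemma keys_mult_mons:
  fixes p q :: "'k::field mpol"
  assumes "keys p \<subseteq> mons V" "keys q \<subseteq> mons V"
  shows "keys (p * q) \<subseteq> mons V"
proof
  fix m assume "m \<in> keys (p * q)"
  then obtain a b where "m = a + b" "a \<in> keys p" "b \<in> keys q"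
    using keys_mult[of p q] by auto
  then show "m \<in> mons V"
    using assms by auto
qed

lemma keys_add_mons:
  fixes p q :: "'k::field mpol"
  assumes "keys p \<subseteq> mons V" "keys q \<subseteq> mons V"
  shows "keys (p + q) \<subseteq> mons V"
  using keys_add[of p q] assms by blast

lemma keys_minus_mons:
  fixes p q :: "'k::field mpol"
  assumes "keys p \<subseteq> mons V" "keys q \<subseteq> mons V"
  shows "keys (p - q) \<subseteq> mons V"
  using keys_minus_subset[of p q] assms by blast

section \<open>Polynomial rings on a carrier, and their ideals\<close>

lemma pring_simps [simp]:
  "p \<in> carrier (pring V) \<longleftrightarrow> keys p \<subseteq> mons V"
  "p \<otimes>\<^bsub>pring V\<^esub> q = p * q" "p \<oplus>\<^bsub>pring V\<^esub> q = p + q" "\<one>\<^bsub>pring V\<^esub> = 1" "\<zero>\<^bsub>pring V\<^esub> = 0"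
  by (simp_all add: pring_def)

lemma cring_pring: "cring (pring V :: ('k::field) mpol ring)"
proof (rule cringI)
  show "abelian_group (pring V :: 'k mpol ring)"
  proof (rule abelian_groupI)
    fix x :: "'k mpol" assume "x \<in> carrier (pring V)"
    then show "\<exists>y\<in>carrier (pring V). y \<oplus>\<^bsub>pring V\<^esub> x = \<zero>\<^bsub>pring V\<^esub>"
      by (intro bexI[of _ "- x"]) simp_all
  qed (auto simp: keys_add_mons add.assoc add.commute)
  show "Group.comm_monoid (pring V :: 'k mpol ring)"
    by (rule comm_monoidI) (auto simp: keys_mult_mons mult.assoc mult.commute)
qed (auto simp: algebra_simps)

lemma ring_pring: "ring (pring V :: ('k::field) mpol ring)"
  using cring_pring by (rule cring.axioms)

lemma a_inv_pring:
  fixes x :: "'k::field mpol"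
  assumes "keys x \<subseteq> mons V"
  shows "\<ominus>\<^bsub>pring V\<^esub> x = - x"
proof -
  interpret ring "pring V :: 'k mpol ring" by (rule ring_pring)
  show ?thesis
    by (rule minus_equality) (use assms in simp_all)
qed

lemma ideal_pringI:
  fixes K :: "'k::field mpol set"
  assumes K: "\<And>p. p \<in> K \<Longrightarrow> keys p \<subseteq> mons V" "0 \<in> K" "\<And>p q. p \<in> K \<Longrightarrow> q \<in> K \<Longrightarrow> p + q \<in> K"
    and mult: "\<And>a p. keys a \<subseteq> mons V \<Longrightarrow> p \<in> K \<Longrightarrow> a * p \<in> K"
  shows "ideal K (pring V)"
proof -
  interpret ring "pring V :: 'k mpol ring" by (rule ring_pring)
  show ?thesis
  proof (rule idealI[OF ring_pring])
    have inv: "\<ominus>\<^bsub>pring V\<^esub> p \<in> K" if "p \<in> K" for p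
      using mult[of "- 1" p] K(1) that by (simp add: a_inv_pring)
    show "subgroup K (add_monoid (pring V))"
    proof (rule group.subgroupI[OF a_group])
      show "inv\<^bsub>add_monoid (pring V)\<^esub> p \<in> K" if "p \<in> K" for p
        using inv[OF that] by (simp only: a_inv_def)
    qed (use K in auto)
  next
    fix a x :: "'k mpol" assume "a \<in> K" "x \<in> carrier (pring V)"
    then have "x * a \<in> K"
      using mult by simp
    then show "x \<otimes>\<^bsub>pring V\<^esub> a \<in> K" "a \<otimes>\<^bsub>pring V\<^esub> x \<in> K"
      by (simp_all add: mult.commute)
  qed
qed

lemma
  fixes K :: "'k::field mpol set"
  assumes "ideal K (pring V)"
  shows ideal_pring_subset: "p \<in> K \<Longrightarrow> keys p \<subseteq> mons V"
    and ideal_pring_zero: "0 \<in> K"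
    and ideal_pring_add: "p \<in> K \<Longrightarrow> q \<in> K \<Longrightarrow> p + q \<in> K"
    and ideal_pring_mult: "p \<in> K \<Longrightarrow> keys a \<subseteq> mons V \<Longrightarrow> a * p \<in> K"
proof -
  interpret ideal K "pring V" by fact
  show sub: "p \<in> K \<Longrightarrow> keys p \<subseteq> mons V"
    using subsetD[OF a_subset, of p] by simp
  show "0 \<in> K" "p \<in> K \<Longrightarrow> q \<in> K \<Longrightarrow> p + q \<in> K"
    using additive_subgroup.zero_closed[OF additive_subgroup_axioms]
      additive_subgroup.a_closed[OF additive_subgroup_axioms, of p q] by simp_all
  show "p \<in> K \<Longrightarrow> keys a \<subseteq> mons V \<Longrightarrow> a * p \<in> K"
    using I_l_closed[of p a] by simp
qed

lemma ideal_pring_uminus: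
  fixes K :: "'k::field mpol set"
  assumes "ideal K (pring V)" "p \<in> K"
  shows "- p \<in> K"
  using ideal_pring_mult[OF assms, of "- 1"] by simp

lemma ideal_pring_minus:
  fixes K :: "'k::field mpol set"
  assumes "ideal K (pring V)" "p \<in> K" "q \<in> K"
  shows "p - q \<in> K"
  using ideal_pring_add[OF assms(1,2) ideal_pring_uminus[OF assms(1,3)]] by simp

lemma ideal_pring_sum:
  fixes K :: "'k::field mpol set"
  assumes "ideal K (pring V)" "\<And>i. i \<in> S \<Longrightarrow> f i \<in> K"
  shows "(\<Sum>i\<in>S. f i) \<in> K"
  using assms(2)
  by (induction S rule: infinite_finite_induct)
    (auto intro: ideal_pring_zero[OF assms(1)] ideal_pring_add[OF assms(1)])

lemma rcoset_pring_eq_iff: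
  fixes K :: "'k::field mpol set"
  assumes "ideal K (pring V)" "keys p \<subseteq> mons V"
  shows "K +>\<^bsub>pring V\<^esub> p = K \<longleftrightarrow> p \<in> K"
proof -
  interpret ideal K "pring V" by fact
  show ?thesis
    using a_rcos_const[of p] a_rcos_self[of p] assms(2) by auto
qed

text \<open>Multiples and sums of terms can only involve monomials divisible by a generator, and
  each such monomial is a multiple of one. Zero coefficients are allowed because the initial term of
  0 is 0; such generators contribute no monomial.\<close>

lemma Idl_single_eq:
  fixes c :: "'a \<Rightarrow> 'k::field"
  assumes e: "\<And>g. g \<in> G \<Longrightarrow> c g \<noteq> 0 \<Longrightarrow> e g \<in> mons V"
  shows "Idl\<^bsub>pring V\<^esub> ((\<lambda>g. Poly_Mapping.single (e g) (c g)) ` G) =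
    {p. keys p \<subseteq> mons V \<and> (\<forall>m\<in>keys p. \<exists>g\<in>G. c g \<noteq> 0 \<and> mon_dvd (e g) m)}"
    (is "Idl\<^bsub>_\<^esub> ?S = ?K")
proof
  interpret ring "pring V :: 'k mpol ring" by (rule ring_pring)
  have "ideal ?K (pring V)"
  proof (rule ideal_pringI)
    fix p q assume "p \<in> ?K" "q \<in> ?K"
    then show "p + q \<in> ?K"
      using keys_add[of p q] by blast
  next
    fix a p :: "'k mpol" assume *: "keys a \<subseteq> mons V" "p \<in> ?K"
    have "\<exists>g\<in>G. c g \<noteq> 0 \<and> mon_dvd (e g) m" if "m \<in> keys (a * p)" for m
    proof -
      obtain x y where xy: "m = x + y" "y \<in> keys p"
        using \<open>m \<in> keys (a * p)\<close> keys_mult[of a p] by auto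
      then obtain g where "g \<in> G" "c g \<noteq> 0" "mon_dvd (e g) y"
        using *(2) by auto
      then show ?thesis
        using xy(1) mon_dvd_trans mon_dvd_add(2) by blast
    qed
    then show "a * p \<in> ?K"
      using keys_mult_mons[of a V p] * by blast
  qed auto
  moreover have "?S \<subseteq> ?K"
  proof (rule image_subsetI)
    fix g assume "g \<in> G"
    then show "Poly_Mapping.single (e g) (c g) \<in> ?K"
      using e[of g] by (cases "c g = 0") auto
  qed
  ultimately show "Idl\<^bsub>pring V\<^esub> ?S \<subseteq> ?K"
    by (rule genideal_minimal)
  have carr: "?S \<subseteq> carrier (pring V)"
  proof (rule image_subsetI)
    fix g assume "g \<in> G"
    then show "Poly_Mapping.single (e g) (c g) \<in> carrier (pring V)"
      using e[of g] by (cases "c g = 0") auto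
  qed
  have idl: "ideal (Idl\<^bsub>pring V\<^esub> ?S) (pring V)"
    using carr by (rule genideal_ideal)
  show "?K \<subseteq> Idl\<^bsub>pring V\<^esub> ?S"
  proof
    fix p assume p: "p \<in> ?K"
    have "Poly_Mapping.single m (lookup p m) \<in> Idl\<^bsub>pring V\<^esub> ?S" if m: "m \<in> keys p" for m
    proof -
      obtain g where g: "g \<in> G" "c g \<noteq> 0" "mon_dvd (e g) m"
        using p m by auto
      then obtain x where x: "m = e g + x"
        by (auto simp: mon_dvd_def)
      have "m \<in> mons V"
        using p m by auto
      then have xV: "x \<in> mons V"
        by (simp add: x)
      have "Poly_Mapping.single (e g) (c g) \<in> Idl\<^bsub>pring V\<^esub> ?S"
        using genideal_self[OF carr] g(1) by auto
      then have "Poly_Mapping.single x (lookup p m / c g) * Poly_Mapping.single (e g) (c g)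
          \<in> Idl\<^bsub>pring V\<^esub> ?S"
        using idl xV by (intro ideal_pring_mult) auto
      also have "Poly_Mapping.single x (lookup p m / c g) * Poly_Mapping.single (e g) (c g)
          = Poly_Mapping.single m (lookup p m)"
        using g(2) by (simp add: mult_single x add.commute)
      finally show ?thesis .
    qed
    then have "(\<Sum>m\<in>keys p. Poly_Mapping.single m (lookup p m)) \<in> Idl\<^bsub>pring V\<^esub> ?S"
      by (intro ideal_pring_sum[OF idl])
    then show "p \<in> Idl\<^bsub>pring V\<^esub> ?S"
      by (simp add: sum_single_lookup)
  qed
qed

lemma Idl_xmon_eq:
  assumes "S \<subseteq> mons V"
  shows "Idl\<^bsub>pring V\<^esub> (xmon ` S) =
    {p :: 'k::field mpol. keys p \<subseteq> mons V \<and> (\<forall>m\<in>keys p. \<exists>s\<in>S. mon_dvd s m)}"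
  using Idl_single_eq[of S "\<lambda>_. 1" "\<lambda>s. s" V] assms by (auto simp: xmon_def[abs_def])

lemma Idl_init_term_eq:
  fixes G :: "'k::field mpol set"
  assumes "\<And>g. g \<in> G \<Longrightarrow> keys g \<subseteq> mons V"
  shows "Idl\<^bsub>pring V\<^esub> (init_term w ` G) =
    {p. keys p \<subseteq> mons V \<and> (\<forall>m\<in>keys p. \<exists>g\<in>G. g \<noteq> 0 \<and> mon_dvd (lmon w g) m)}"
proof -
  have "lmon w g \<in> mons V" if "g \<in> G" "lcoeff w g \<noteq> 0" for g
    using assms[OF that(1)] lmon_in_keys[of g w] that(2) by auto
  then show ?thesis
    using Idl_single_eq[of G "lcoeff w" "lmon w" V] by (simp add: init_term_def[abs_def])
qed

text \<open>A set of monomials generates \<open>K\<close> exactly when it lies in \<open>S\<close>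
  and contains all minimal elements of \<open>S\<close>. The minimal elements are therefore the
  least generating set and the only irredundant one.\<close>

lemma min_mon_gens_eq:
  fixes K :: "'k::field mpol set"
  assumes S: "S \<subseteq> mons V" and K: "K = {p. keys p \<subseteq> S}"
    and up: "\<And>s m. s \<in> S \<Longrightarrow> mon_dvd s m \<Longrightarrow> m \<in> mons V \<Longrightarrow> m \<in> S"
  shows "min_mon_gens V K = min_elems S"
proof -
  have gen: "Idl\<^bsub>pring V\<^esub> (xmon ` T) = K \<longleftrightarrow> T \<subseteq> S \<and> min_elems S \<subseteq> T"
    if T: "T \<subseteq> mons V" for T
  proof
    assume *: "Idl\<^bsub>pring V\<^esub> (xmon ` T) = K"
    have "xmon t \<in> K" if "t \<in> T" for t
      unfolding *[symmetric] Idl_xmon_eq[OF T] using T that by (auto intro: bexI[of _ t])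
    then have "T \<subseteq> S"
      by (auto simp: K)
    moreover have "s \<in> T" if "s \<in> min_elems S" for s
    proof -
      have "s \<in> S"
        using that by (simp add: min_elems_def)
      then have "(xmon s :: 'k mpol) \<in> K"
        by (simp add: K)
      then obtain t where "t \<in> T" "mon_dvd t s"
        unfolding *[symmetric] Idl_xmon_eq[OF T] by auto
      with \<open>T \<subseteq> S\<close> that show ?thesis
        by (auto simp: min_elems_def)
    qed
    ultimately show "T \<subseteq> S \<and> min_elems S \<subseteq> T"
      by blast
  next
    assume *: "T \<subseteq> S \<and> min_elems S \<subseteq> T"
    have "(m \<in> mons V \<and> (\<exists>t\<in>T. mon_dvd t m)) \<longleftrightarrow> m \<in> S" for m
      using * ex_min_elem_dvd[of m S] up S by blast
    then show "Idl\<^bsub>pring V\<^esub> (xmon ` T) = K"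
      unfolding Idl_xmon_eq[OF T] K by blast
  qed
  have minV: "min_elems S \<subseteq> mons V"
    using S min_elems_subset by blast
  show ?thesis
    unfolding min_mon_gens_def
  proof (rule the_equality, intro conjI allI impI)
    show "Idl\<^bsub>pring V\<^esub> (xmon ` min_elems S) = K"
      unfolding gen[OF minV] using min_elems_subset by auto
    show "Idl\<^bsub>pring V\<^esub> (xmon ` S') \<noteq> K" if "S' \<subset> min_elems S" for S'
    proof -
      have "S' \<subseteq> mons V"
        using that minV by blast
      then show ?thesis
        using gen[of S'] that by blast
    qed
  next
    fix T assume T: "T \<subseteq> mons V \<and> Idl\<^bsub>pring V\<^esub> (xmon ` T) = K \<and>
      (\<forall>S'. S' \<subset> T \<longrightarrow> Idl\<^bsub>pring V\<^esub> (xmon ` S') \<noteq> K)"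
    then have "min_elems S \<subseteq> T"
      using gen[of T] by blast
    moreover have "Idl\<^bsub>pring V\<^esub> (xmon ` min_elems S) = K"
      unfolding gen[OF minV] using min_elems_subset by auto
    ultimately show "T = min_elems S"
      using T by blast
  qed (rule minV)
qed

section \<open>Division and reduced Groebner bases\<close>

lemma lmon_mult_single:
  fixes f :: "'k::field mpol"
  assumes "f \<noteq> 0" "c \<noteq> 0"
  shows "lmon w (f * Poly_Mapping.single s c) = lmon w f + s"
proof (rule lmon_eqI)
  show "lmon w f + s \<in> keys (f * Poly_Mapping.single s c)"
    using assms lmon_in_keys[of f w] by (simp add: keys_mult_single)
  show "wle w m' (lmon w f + s)" if "m' \<in> keys (f * Poly_Mapping.single s c)" for m'
    using that assms wle_lmon[of f _ w] by (auto simp: keys_mult_single)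
qed

context weights
begin

text \<open>The bound \<open>b\<close> replaces the leading monomial of \<open>f\<close>, so that
  the induction can run over monomials and include \<open>f = 0\<close>. The bound on the products
  is the one demanded by \<open>is_remainder\<close>; the bound on \<open>r\<close> later shows that
  a normal form does not exceed the leading monomial of its argument.\<close>

lemma division:
  fixes f :: "'k::field mpol" and G :: "'k mpol set"
  assumes G: "finite G" "0 \<notin> G" "\<And>g. g \<in> G \<Longrightarrow> keys g \<subseteq> mons V"
    and "b \<in> mons V" "keys f \<subseteq> mons V" "\<And>m. m \<in> keys f \<Longrightarrow> wle w m b"
  shows "\<exists>q r. (\<forall>g\<in>G. keys (q g) \<subseteq> mons V) \<and> keys r \<subseteq> mons V \<and> f = (\<Sum>g\<in>G. q g * g) + r \<and>
    (\<forall>g\<in>G. \<forall>m\<in>keys (q g * g). wle w m b) \<and> (\<forall>m\<in>keys r. wle w m b) \<and>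
    (\<forall>m\<in>keys r. \<forall>g\<in>G. \<not> mon_dvd (lmon w g) m)"
    (is "?P f b")
  using assms(4-)
proof (induction b arbitrary: f rule: mons_wrevlex_induct)
  case (less b)
  \<comment> \<open>Once the term at \<open>b\<close> is gone, the leading monomial of what is left
    lies strictly below \<open>b\<close>. The induction hypothesis applies there and its bounds
    weaken to \<open>b\<close>.\<close>
  have below: "?P f' b" if f': "keys f' \<subseteq> mons V" "\<And>m. m \<in> keys f' \<Longrightarrow> wle w m b" "b \<notin> keys f'" for f'
  proof (cases "f' = 0")
    case True
    then show ?thesis
      by (intro exI[of _ "\<lambda>_. 0"] exI[of _ 0]) simp
  next
    case False
    define b' where "b' = lmon w f'"
    have b': "b' \<in> keys f'" "\<And>m. m \<in> keys f' \<Longrightarrow> wle w m b'"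
      using lmon_in_keys[OF False] wle_lmon[OF False] by (auto simp: b'_def)
    then have lt: "wrevlex w b b'"
      using f' wle_iff by metis
    have "b' \<in> mons V"
      using b'(1) f'(1) by blast
    then have "?P f' b'"
      using lt f'(1) b'(2) by (rule less.IH)
    then obtain q r where "\<forall>g\<in>G. keys (q g) \<subseteq> mons V" "keys r \<subseteq> mons V"
      "\<forall>m\<in>keys r. \<forall>g\<in>G. \<not> mon_dvd (lmon w g) m" "f' = (\<Sum>g\<in>G. q g * g) + r"
      "\<forall>g\<in>G. \<forall>m\<in>keys (q g * g). wle w m b'" "\<forall>m\<in>keys r. wle w m b'"
      by blast
    moreover have "wle w m b" if "wle w m b'" for m
      using that lt wle_trans[of w m b' b] by (simp add: wle_iff)
    ultimately show ?thesis
      by (intro exI[of _ q] exI[of _ r] conjI) auto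
  qed
  show ?case
  proof (cases "b \<in> keys f")
    case False
    then show ?thesis
      using less.prems by (intro below)
  next
    case True
    show ?thesis
    proof (cases "\<exists>g\<in>G. mon_dvd (lmon w g) b")
      case True
      then obtain g c where g: "g \<in> G" and c: "b = lmon w g + c"
        by (auto simp: mon_dvd_def)
      have g0: "g \<noteq> 0"
        using g G(2) by auto
      \<comment> \<open>The factor is chosen so that \<open>t * g\<close> has the same coefficient
        at \<open>b\<close> as \<open>f\<close>; subtracting it cancels that term and creates
        nothing above \<open>b\<close>.\<close>
      define t where "t = Poly_Mapping.single c (lookup f b / lcoeff w g)"
      have cV: "c \<in> mons V"
        using less.hyps by (simp add: c)
      have nz: "lookup f b / lcoeff w g \<noteq> 0"
        using \<open>b \<in> keys f\<close> g0 by (simp add: in_keys_iff)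
      have keys_tg: "keys (t * g) = (\<lambda>m. m + c) ` keys g"
        using keys_mult_single[OF nz, of g c] by (simp add: t_def mult.commute)
      have tg_V: "keys (t * g) \<subseteq> mons V"
        using G(3)[OF g] cV by (auto simp: keys_tg)
      have tg_le: "wle w m b" if "m \<in> keys (t * g)" for m
        using that wle_lmon[OF g0, of _ w] by (auto simp: keys_tg c)
      have "lookup (t * g) b = lookup f b"
        using lookup_mult_single[of g c "lookup f b / lcoeff w g" "lmon w g"] g0
        by (simp add: t_def c mult.commute lcoeff_def[symmetric])
      then have "b \<notin> keys (f - t * g)"
        by (simp add: in_keys_iff lookup_minus)
      moreover have "keys (f - t * g) \<subseteq> mons V"
        using less.prems(1) tg_V by (rule keys_minus_mons)
      moreover have "wle w m b" if "m \<in> keys (f - t * g)" for m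
        using that keys_minus_subset[of f "t * g"] less.prems(2) tg_le by blast
      ultimately have "?P (f - t * g) b"
        by (intro below)
      then obtain q r where q: "\<forall>g\<in>G. keys (q g) \<subseteq> mons V"
        and r: "keys r \<subseteq> mons V" "\<forall>m\<in>keys r. wle w m b" "\<forall>m\<in>keys r. \<forall>g\<in>G. \<not> mon_dvd (lmon w g) m"
        and eq: "f - t * g = (\<Sum>g\<in>G. q g * g) + r"
        and q_le: "\<forall>g\<in>G. \<forall>m\<in>keys (q g * g). wle w m b"
        by blast
      define q' where "q' = (\<lambda>h. q h + (if h = g then t else 0))"
      have "(\<Sum>h\<in>G. q' h * h) = (\<Sum>h\<in>G. q h * h + (if h = g then t * h else 0))"
        by (intro sum.cong) (auto simp: q'_def distrib_right)
      also have "\<dots> = (\<Sum>h\<in>G. q h * h) + t * g"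
        using g G(1) by (simp add: sum.distrib)
      finally have "f = (\<Sum>h\<in>G. q' h * h) + r"
        using eq by (simp add: algebra_simps)
      moreover have "keys (q' h) \<subseteq> mons V" if "h \<in> G" for h
      proof -
        have "keys t \<subseteq> mons V"
          using cV by (simp add: t_def)
        then have "keys (q h + t) \<subseteq> mons V"
          using q that keys_add_mons by blast
        then show ?thesis
          using bspec[OF q that] unfolding q'_def by (cases "h = g") simp_all
      qed
      moreover have "wle w m b" if "h \<in> G" "m \<in> keys (q' h * h)" for h m
      proof -
        have "q' h * h = q h * h + (if h = g then t * g else 0)"
          by (simp add: q'_def distrib_right)
        then have "m \<in> keys (q h * h) \<or> m \<in> keys (t * g)"
          using that(2) keys_add[of "q h * h" "t * g"] by (auto split: if_splits)
        then show ?thesis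
          using q_le that(1) tg_le by blast
      qed
      ultimately show ?thesis
        using r by (intro exI[of _ q'] exI[of _ r] conjI) auto
    next
      case False
      \<comment> \<open>No leading monomial divides \<open>b\<close>, so the whole term at
        \<open>b\<close> is passed to the remainder.\<close>
      define s where "s = Poly_Mapping.single b (lookup f b)"
      have s: "keys s = {b}"
        using \<open>b \<in> keys f\<close> by (simp add: s_def in_keys_iff)
      have "b \<notin> keys (f - s)"
        by (simp add: in_keys_iff lookup_minus s_def)
      moreover have "keys (f - s) \<subseteq> mons V"
        using less.prems(1) s less.hyps by (intro keys_minus_mons) auto
      moreover have "wle w m b" if "m \<in> keys (f - s)" for m
        using that keys_minus_subset[of f s] less.prems(2) s by auto
      ultimately have "?P (f - s) b"
        by (intro below)
      then obtain q r where q: "\<forall>g\<in>G. keys (q g) \<subseteq> mons V"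
        and r: "keys r \<subseteq> mons V" "\<forall>m\<in>keys r. wle w m b" "\<forall>m\<in>keys r. \<forall>g\<in>G. \<not> mon_dvd (lmon w g) m"
        and eq: "f - s = (\<Sum>g\<in>G. q g * g) + r"
        and q_le: "\<forall>g\<in>G. \<forall>m\<in>keys (q g * g). wle w m b"
        by blast
      have rs: "m = b \<or> m \<in> keys r" if "m \<in> keys (r + s)" for m
        using that keys_add[of r s] s by auto
      have "m \<in> mons V \<and> wle w m b \<and> (\<forall>g\<in>G. \<not> mon_dvd (lmon w g) m)" if "m \<in> keys (r + s)" for m
        using rs[OF that]
      proof
        assume "m = b"
        then show ?thesis
          using less.hyps False by simp
      next
        assume "m \<in> keys r"
        then show ?thesis
          using r by blast
      qed
      then have "keys (r + s) \<subseteq> mons V" "\<forall>m\<in>keys (r + s). wle w m b"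
        "\<forall>m\<in>keys (r + s). \<forall>g\<in>G. \<not> mon_dvd (lmon w g) m"
        by blast+
      moreover have "f = (\<Sum>g\<in>G. q g * g) + (r + s)"
        using eq by (simp add: algebra_simps)
      ultimately show ?thesis
        using q q_le by (intro exI[of _ q] exI[of _ "r + s"] conjI) auto
    qed
  qed
qed

end

text \<open>Zero is removed because its \<open>lmon\<close> describes an element of the empty set
  and is thus an unspecified monomial.\<close>

definition lead_mons :: "(nat \<Rightarrow> nat) \<Rightarrow> ('k::field) mpol set \<Rightarrow> mon set" where
  "lead_mons w I = lmon w ` (I - {0})"

section \<open>Initial ideal, normal forms and reduced Groebner basis of one ideal\<close>

locale weighted_ideal =
  fixes n :: nat and w :: "nat \<Rightarrow> nat" and I :: "('k::field) mpol set"
  assumes weights_pos: "\<forall>i\<in>{1..n}. 0 < w i"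
    and ideal_I: "ideal I (pring {1..n})"
begin

sublocale weights "{1..n}" w
  using weights_pos by unfold_locales simp_all

abbreviation L :: "mon set" where
  "L \<equiv> lead_mons w I"

lemmas I_simps = ideal_pring_subset[OF ideal_I] ideal_pring_zero[OF ideal_I]
  ideal_pring_add[OF ideal_I] ideal_pring_minus[OF ideal_I] ideal_pring_mult[OF ideal_I]
  ideal_pring_sum[OF ideal_I]

lemma lead_mons_subset: "L \<subseteq> mons {1..n}"
  using lmon_in_keys[of _ w] I_simps(1) by (fastforce simp: lead_mons_def)

lemma lead_mons_dvd_closed:
  assumes "s \<in> L" "mon_dvd s m" "m \<in> mons {1..n}"
  shows "m \<in> L"
proof -
  obtain f where f: "f \<in> I" "f \<noteq> 0" "s = lmon w f"
    using assms(1) by (auto simp: lead_mons_def)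
  obtain c where c: "m = s + c"
    using assms(2) by (auto simp: mon_dvd_def)
  have "c \<in> mons {1..n}"
    using assms(3) by (simp add: c)
  then have "f * xmon c \<in> I"
    using I_simps(5)[OF f(1), of "xmon c"] by (simp add: mult.commute)
  moreover have "f * xmon c \<noteq> 0"
    using keys_mult_single[of 1 f c] f(2) by (force simp: xmon_def)
  moreover have "lmon w (f * xmon c) = m"
    using lmon_mult_single[OF f(2), of 1 w c] by (simp add: xmon_def c f(3))
  ultimately show ?thesis
    by (auto simp: lead_mons_def)
qed

lemma eq_0_if_no_lead_mons:
  assumes "f \<in> I" "keys f \<inter> L = {}"
  shows "f = 0"
  using assms lmon_in_keys[of f w] by (auto simp: lead_mons_def)

text \<open>Since \<open>L\<close> is closed under multiples, divisibility by a leading monomial of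
  I is the same as membership in \<open>L\<close>.\<close>

lemma init_ideal_eq: "init_ideal n w I = {p. keys p \<subseteq> L}"
proof -
  have "(keys p \<subseteq> mons {1..n} \<and> (\<forall>m\<in>keys p. \<exists>g\<in>I. g \<noteq> 0 \<and> mon_dvd (lmon w g) m))
      \<longleftrightarrow> keys p \<subseteq> L" for p :: "'k mpol"
  proof
    assume "keys p \<subseteq> mons {1..n} \<and> (\<forall>m\<in>keys p. \<exists>g\<in>I. g \<noteq> 0 \<and> mon_dvd (lmon w g) m)"
    then show "keys p \<subseteq> L"
      using lead_mons_dvd_closed by (fastforce simp: lead_mons_def)
  next
    assume p: "keys p \<subseteq> L"
    then have "\<exists>g\<in>I. g \<noteq> 0 \<and> mon_dvd (lmon w g) m" if "m \<in> keys p" for m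
      using that by (force simp: lead_mons_def)
    then show "keys p \<subseteq> mons {1..n} \<and> (\<forall>m\<in>keys p. \<exists>g\<in>I. g \<noteq> 0 \<and> mon_dvd (lmon w g) m)"
      using p lead_mons_subset by blast
  qed
  then show ?thesis
    unfolding init_ideal_def using Idl_init_term_eq[of I "{1..n}" w, OF I_simps(1)] by simp
qed

lemma init_ideal_generated_iff:
  assumes "G \<subseteq> I"
  shows "Idl\<^bsub>pring {1..n}\<^esub> (init_term w ` G) = init_ideal n w I
    \<longleftrightarrow> (\<forall>s\<in>L. \<exists>g\<in>G. g \<noteq> 0 \<and> mon_dvd (lmon w g) s)"
proof -
  have G: "Idl\<^bsub>pring {1..n}\<^esub> (init_term w ` G) =
    {p. keys p \<subseteq> mons {1..n} \<and> (\<forall>m\<in>keys p. \<exists>g\<in>G. g \<noteq> 0 \<and> mon_dvd (lmon w g) m)}"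
    using assms I_simps(1) by (intro Idl_init_term_eq) blast
  show ?thesis
  proof
    assume *: "Idl\<^bsub>pring {1..n}\<^esub> (init_term w ` G) = init_ideal n w I"
    show "\<forall>s\<in>L. \<exists>g\<in>G. g \<noteq> 0 \<and> mon_dvd (lmon w g) s"
    proof
      fix s assume "s \<in> L"
      then have "(xmon s :: 'k mpol) \<in> init_ideal n w I"
        by (simp add: init_ideal_eq)
      then show "\<exists>g\<in>G. g \<noteq> 0 \<and> mon_dvd (lmon w g) s"
        unfolding *[symmetric] G by simp
    qed
  next
    assume *: "\<forall>s\<in>L. \<exists>g\<in>G. g \<noteq> 0 \<and> mon_dvd (lmon w g) s"
    have "m \<in> L" if "m \<in> mons {1..n}" "g \<in> G" "g \<noteq> 0" "mon_dvd (lmon w g) m" for m g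
      using that assms by (intro lead_mons_dvd_closed[of "lmon w g" m]) (auto simp: lead_mons_def)
    then show "Idl\<^bsub>pring {1..n}\<^esub> (init_term w ` G) = init_ideal n w I"
      unfolding G init_ideal_eq using * lead_mons_subset by (intro Collect_cong) blast
  qed
qed

text \<open>Only I and \<open>L\<close> enter, and no chosen basis. Hence remainders with respect to
  different Groebner bases can all be identified with this one polynomial.\<close>

definition nf :: "'k mpol \<Rightarrow> 'k mpol" where
  "nf f = (THE r. keys r \<subseteq> mons {1..n} - L \<and> f - r \<in> I)"

text \<open>The difference of two candidates lies in I and has no monomial in \<open>L\<close>, so
  it has no leading monomial and vanishes.\<close>

lemma nf_eqI:
  assumes "keys r \<subseteq> mons {1..n} - L" "f - r \<in> I"
  shows "nf f = r"
  unfolding nf_def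
proof (rule the_equality)
  fix r' assume r': "keys r' \<subseteq> mons {1..n} - L \<and> f - r' \<in> I"
  have "(f - r) - (f - r') \<in> I"
    by (rule I_simps(4)) (use assms(2) r' in auto)
  then have "r' - r \<in> I"
    by simp
  moreover have "keys (r' - r) \<inter> L = {}"
    using keys_minus_subset[of r' r] assms(1) r' by blast
  ultimately show "r' = r"
    using eq_0_if_no_lead_mons by fastforce
qed (use assms in auto)

text \<open>By Dickson's lemma finitely many elements of I realize the minimal leading monomials.
  This auxiliary basis, not yet reduced, provides the existence of normal forms, from which the
  reduced basis is then built.\<close>

lemma ex_finite_groebner_basis: "\<exists>G. finite G \<and> G \<subseteq> I - {0} \<and> lmon w ` G = min_elems L"
proof -
  have "finite (min_elems L)"
    using lead_mons_subset finite_min_elems[of "{1..n}" L] by simp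
  moreover have "min_elems L \<subseteq> lmon w ` (I - {0})"
    using min_elems_subset by (auto simp: lead_mons_def)
  ultimately show ?thesis
    using finite_subset_image by metis
qed

lemma
  fixes f :: "'k mpol"
  assumes G: "G \<subseteq> I - {0}" and r: "is_remainder n w G f r" and gb: "min_elems L \<subseteq> lmon w ` G"
  shows keys_remainder: "keys r \<subseteq> mons {1..n} - L"
    and minus_remainder_in_ideal: "f - r \<in> I"
proof -
  obtain q where q: "keys r \<subseteq> mons {1..n}" "\<forall>g\<in>G. keys (q g) \<subseteq> mons {1..n}"
    "f = (\<Sum>g\<in>G. q g * g) + r" "\<forall>m\<in>keys r. \<forall>g\<in>G. \<not> mon_dvd (lmon w g) m"
    using r unfolding is_remainder_def by auto
  have "f - r = (\<Sum>g\<in>G. q g * g)"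
    by (simp add: q(3))
  also have "\<dots> \<in> I"
    using G q(2) by (intro I_simps(5,6)) auto
  finally show "f - r \<in> I" .
  show "keys r \<subseteq> mons {1..n} - L"
  proof
    fix m assume m: "m \<in> keys r"
    then have "m \<notin> L"
      using q(4) gb ex_min_elem_dvd[of m L] by blast
    then show "m \<in> mons {1..n} - L"
      using q(1) m by blast
  qed
qed

lemma remainder_eq_nf:
  fixes f :: "'k mpol"
  assumes "G \<subseteq> I - {0}" "is_remainder n w G f r" "min_elems L \<subseteq> lmon w ` G"
  shows "r = nf f"
  using nf_eqI[OF keys_remainder[OF assms] minus_remainder_in_ideal[OF assms]] by simp

lemma ex_remainder:
  fixes f :: "'k mpol"
  assumes "finite G" "G \<subseteq> I - {0}" "keys f \<subseteq> mons {1..n}"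
  shows "\<exists>r. is_remainder n w G f r \<and> (\<forall>m\<in>keys r. wle w m (lmon w f))"
proof (cases "f = 0")
  case True
  have "is_remainder n w G 0 0"
    unfolding is_remainder_def by (intro conjI exI[of _ "\<lambda>_. 0"]) auto
  with True show ?thesis
    by (intro exI[of _ 0]) simp
next
  case False
  have G: "0 \<notin> G" "\<And>g. g \<in> G \<Longrightarrow> keys g \<subseteq> mons {1..n}"
    using assms(2) I_simps(1) by blast+
  have b: "lmon w f \<in> mons {1..n}"
    using lmon_in_keys[OF False] assms(3) by blast
  obtain q r where *: "\<forall>g\<in>G. keys (q g) \<subseteq> mons {1..n}" "keys r \<subseteq> mons {1..n}"
    "f = (\<Sum>g\<in>G. q g * g) + r" "\<forall>g\<in>G. \<forall>m\<in>keys (q g * g). wle w m (lmon w f)"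
    "\<forall>m\<in>keys r. wle w m (lmon w f)" "\<forall>m\<in>keys r. \<forall>g\<in>G. \<not> mon_dvd (lmon w g) m"
    using division[OF assms(1) G b assms(3) wle_lmon[OF False]] by blast
  have "\<not> wrevlex w (lmon w (q g * g)) (lmon w f)" if "g \<in> G" "q g * g \<noteq> 0" for g
    using *(4) that lmon_in_keys[OF that(2), of w] by (auto simp: wle_def)
  then have "is_remainder n w G f r"
    unfolding is_remainder_def using * False by (intro conjI exI[of _ q]) auto
  with *(5) show ?thesis
    by blast
qed

text \<open>All three facts hold for a remainder produced by division by an auxiliary Groebner
  basis, and such a remainder is the normal form.\<close>

lemma
  fixes f :: "'k mpol"
  assumes "keys f \<subseteq> mons {1..n}"
  shows keys_nf: "keys (nf f) \<subseteq> mons {1..n} - L"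
    and minus_nf_in_ideal: "f - nf f \<in> I"
    and nf_wle: "m \<in> keys (nf f) \<Longrightarrow> wle w m (lmon w f)"
proof -
  obtain G where G: "finite G" "G \<subseteq> I - {0}" "lmon w ` G = min_elems L"
    using ex_finite_groebner_basis by blast
  obtain r where r: "is_remainder n w G f r" "\<forall>m\<in>keys r. wle w m (lmon w f)"
    using ex_remainder[OF G(1,2) assms] by blast
  have min: "min_elems L \<subseteq> lmon w ` G"
    by (simp add: G(3))
  have eq: "r = nf f"
    using G(2) r(1) min by (rule remainder_eq_nf)
  show "m \<in> keys (nf f) \<Longrightarrow> wle w m (lmon w f)"
    using r(2) eq by simp
  show "f - nf f \<in> I" "keys (nf f) \<subseteq> mons {1..n} - L"
    using minus_remainder_in_ideal[OF G(2) r(1) min] keys_remainder[OF G(2) r(1) min]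
    by (simp_all add: eq)
qed

text \<open>For minimal \<open>s\<close> in \<open>L\<close> this is a member of the reduced
  Groebner basis; for \<open>s\<close> in \<open>B1'\<close> it is the image of
  \<open>h_elem\<close> in the polynomial ring.\<close>

definition gb_elem :: "mon \<Rightarrow> 'k mpol" where
  "gb_elem s = xmon s - nf (xmon s)"

lemma lmon_xmon [simp]: "lmon w (xmon s :: 'k mpol) = s"
  by (rule lmon_eqI) auto

text \<open>The normal form avoids \<open>L\<close> while \<open>s\<close> belongs to it, so nothing
  cancels at \<open>s\<close>. The remaining monomials are at most \<open>s\<close> in the
  order.\<close>

lemma
  assumes "s \<in> L"
  shows gb_elem_in_ideal: "gb_elem s \<in> I"
    and keys_gb_elem: "keys (gb_elem s) = insert s (keys (nf (xmon s)))"
    and lmon_gb_elem: "lmon w (gb_elem s) = s"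
    and lcoeff_gb_elem: "lcoeff w (gb_elem s) = 1"
proof -
  have s: "keys (xmon s :: 'k mpol) \<subseteq> mons {1..n}"
    using assms lead_mons_subset by auto
  show "gb_elem s \<in> I"
    unfolding gb_elem_def by (rule minus_nf_in_ideal[OF s])
  have "lookup (nf (xmon s)) s = 0"
    using keys_nf[OF s] assms by (auto simp: in_keys_iff)
  then have lookup: "lookup (gb_elem s) m = (if m = s then 1 else - lookup (nf (xmon s)) m)" for m
    by (auto simp: gb_elem_def lookup_minus lookup_xmon)
  then show keys: "keys (gb_elem s) = insert s (keys (nf (xmon s)))"
    by (auto simp: in_keys_iff split: if_splits)
  show lmon: "lmon w (gb_elem s) = s"
    by (rule lmon_eqI) (use nf_wle[OF s] in \<open>auto simp: keys\<close>)
  show "lcoeff w (gb_elem s) = 1"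
    by (simp add: lcoeff_def lmon lookup)
qed

text \<open>Existence and uniqueness in one equivalence, which evaluates the description in
  \<open>reduced_gb\<close>. Reducedness keeps the tail of each \<open>g\<close> outside
  \<open>L\<close>, so the tail is the negative of a normal form and \<open>g\<close> is determined
  by its leading monomial.\<close>

lemma is_reduced_gb_iff: "is_reduced_gb n w I G \<longleftrightarrow> G = gb_elem ` min_elems L"
proof
  assume G: "is_reduced_gb n w I G"
  then have fin: "finite G" and GI: "G \<subseteq> I" and lc: "\<And>g. g \<in> G \<Longrightarrow> lcoeff w g = 1"
    and red: "\<And>g m. g \<in> G \<Longrightarrow> m \<in> keys g \<Longrightarrow> xmon m \<notin> Idl\<^bsub>pring {1..n}\<^esub> (init_term w ` (G - {g}))"
    and gen: "\<And>s. s \<in> L \<Longrightarrow> \<exists>g\<in>G. mon_dvd (lmon w g) s"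
    using init_ideal_generated_iff[of G] unfolding is_reduced_gb_def by blast+
  have nz: "g \<noteq> 0" if "g \<in> G" for g
    using lc[OF that] by (metis lcoeff_eq_0_iff zero_neq_one)
  have lead: "lmon w g \<in> L" if "g \<in> G" for g
    using that nz GI by (auto simp: lead_mons_def)
  have GV: "keys g \<subseteq> mons {1..n}" if "g \<in> G" for g
    using that GI I_simps(1) by blast
  \<comment> \<open>Reducedness as divisibility: among the leading monomials of \<open>G\<close>,
    only that of \<open>g\<close> can divide a monomial of \<open>g\<close>.\<close>
  have red': "g' = g" if g: "g \<in> G" "g' \<in> G" "m \<in> keys g" "mon_dvd (lmon w g') m" for g g' m
  proof (rule ccontr)
    assume "g' \<noteq> g"
    then have "xmon m \<in> Idl\<^bsub>pring {1..n}\<^esub> (init_term w ` (G - {g}))"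
      using g GV nz by (subst Idl_init_term_eq) auto
    with red[OF g(1,3)] show False by simp
  qed
  have G_eq: "g = gb_elem (lmon w g)" if g: "g \<in> G" for g
  proof -
    \<comment> \<open>A tail monomial in \<open>L\<close> would be a multiple of the leading
      monomial of \<open>g\<close>, hence not smaller than it.\<close>
    have tail: "m \<notin> L" if m: "m \<in> keys g" "m \<noteq> lmon w g" for m
    proof
      assume "m \<in> L"
      then obtain g' where g': "g' \<in> G" "mon_dvd (lmon w g') m"
        using gen by blast
      then have "mon_dvd (lmon w g) m"
        using red'[OF g g'(1) m(1)] by simp
      then have "wle w (lmon w g) m"
        using GV[OF g] m(1) by (intro mon_dvd_imp_wle) auto
      then show False
        using wle_lmon[OF nz[OF g] m(1), of w] m(2) wle_antisym by blast
    qed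
    have "nf (xmon (lmon w g)) = xmon (lmon w g) - g"
    proof (rule nf_eqI)
      have lk: "lookup g (lmon w g) = 1"
        using lc[OF g] by (simp add: lcoeff_def)
      have keys: "m \<in> keys g \<and> m \<noteq> lmon w g" if "m \<in> keys (xmon (lmon w g) - g)" for m
        using that lk by (auto simp: in_keys_iff lookup_minus lookup_xmon split: if_splits)
      show "keys (xmon (lmon w g) - g) \<subseteq> mons {1..n} - L"
        using keys tail GV[OF g] by blast
    qed (use g GI in auto)
    then show ?thesis
      by (simp add: gb_elem_def)
  qed
  have "lmon w ` G = min_elems L"
  proof
    show "min_elems L \<subseteq> lmon w ` G"
    proof
      fix s assume s: "s \<in> min_elems L"
      then obtain g where "g \<in> G" "mon_dvd (lmon w g) s"
        using gen min_elems_subset by blast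
      with s lead show "s \<in> lmon w ` G"
        by (auto simp: min_elems_def)
    qed
    show "lmon w ` G \<subseteq> min_elems L"
    proof (rule image_subsetI)
      fix g assume g: "g \<in> G"
      have "t = lmon w g" if "t \<in> L" "mon_dvd t (lmon w g)" for t
      proof -
        obtain g' where g': "g' \<in> G" "mon_dvd (lmon w g') t"
          using gen[OF \<open>t \<in> L\<close>] by blast
        then have "g' = g"
          using red'[OF g g'(1) lmon_in_keys[OF nz[OF g], of w]] mon_dvd_trans that(2) by blast
        then have "mon_dvd (lmon w g) t"
          using g' by simp
        then show ?thesis
          using that(2) by (intro poly_mapping_eqI) (auto simp: mon_dvd_iff intro: le_antisym)
      qed
      then show "lmon w g \<in> min_elems L"
        using lead[OF g] by (auto simp: min_elems_def)
    qed
  qed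
  then have "gb_elem ` min_elems L = (\<lambda>g. gb_elem (lmon w g)) ` G"
    by (metis image_image)
  also have "\<dots> = G"
    using G_eq by simp
  finally show "G = gb_elem ` min_elems L" ..
next
  let ?G = "gb_elem ` min_elems L"
  have L: "s \<in> L" if "s \<in> min_elems L" for s
    using that min_elems_subset by blast
  have nz: "gb_elem s \<noteq> 0" if "s \<in> min_elems L" for s
    using lcoeff_gb_elem[OF L[OF that]] by (metis lcoeff_eq_0_iff zero_neq_one)
  have GI: "?G \<subseteq> I"
    using L gb_elem_in_ideal by blast
  have GV: "keys g \<subseteq> mons {1..n}" if "g \<in> ?G" for g
    using that GI I_simps(1) by blast
  assume "G = ?G"
  moreover have "finite ?G"
    using finite_min_elems[of "{1..n}" L] lead_mons_subset by simp
  moreover have "\<forall>s\<in>L. \<exists>g\<in>?G. g \<noteq> 0 \<and> mon_dvd (lmon w g) s"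
    using ex_min_elem_dvd L nz lmon_gb_elem by (metis imageI)
  then have "Idl\<^bsub>pring {1..n}\<^esub> (init_term w ` ?G) = init_ideal n w I"
    using init_ideal_generated_iff[OF GI] by blast
  \<comment> \<open>A multiple of another minimal \<open>t\<close> lies in \<open>L\<close>, and the
    only monomial of \<open>gb_elem s\<close> in \<open>L\<close> is \<open>s\<close>; but
    \<open>t\<close> cannot divide the minimal element \<open>s\<close>.\<close>
  moreover have "xmon m \<notin> Idl\<^bsub>pring {1..n}\<^esub> (init_term w ` (?G - {gb_elem s}))"
    if s: "s \<in> min_elems L" and m: "m \<in> keys (gb_elem s)" for s m
  proof
    assume "xmon m \<in> Idl\<^bsub>pring {1..n}\<^esub> (init_term w ` (?G - {gb_elem s}))"
    then obtain g where g: "g \<in> ?G" "g \<noteq> gb_elem s" "mon_dvd (lmon w g) m" and mV: "m \<in> mons {1..n}"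
      using GV by (subst (asm) Idl_init_term_eq) auto
    then obtain t where "t \<in> min_elems L" "g = gb_elem t"
      by blast
    with g have t: "t \<in> min_elems L" "t \<noteq> s" "mon_dvd t m"
      using lmon_gb_elem[OF L, of t] by auto
    then have "m \<in> L"
      using L mV lead_mons_dvd_closed by blast
    moreover have "m = s \<or> m \<in> keys (nf (xmon s))"
      using m keys_gb_elem[OF L[OF s]] by auto
    moreover have "keys (nf (xmon s)) \<subseteq> mons {1..n} - L"
      using L[OF s] lead_mons_subset by (intro keys_nf) auto
    ultimately have "m = s"
      by blast
    with t s L[OF t(1)] show False
      by (auto simp: min_elems_def)
  qed
  ultimately show "is_reduced_gb n w I G"
    unfolding is_reduced_gb_def using GI L lcoeff_gb_elem by blast
qed

lemma remainder_reduced_gb: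
  fixes f :: "'k mpol"
  assumes "keys f \<subseteq> mons {1..n}"
  shows "remainder n w (reduced_gb n w I) f = nf f"
proof -
  have gb: "reduced_gb n w I = gb_elem ` min_elems L"
    unfolding reduced_gb_def is_reduced_gb_iff by simp
  have L: "s \<in> L" if "s \<in> min_elems L" for s
    using that min_elems_subset by blast
  have "gb_elem s \<noteq> 0" if "s \<in> min_elems L" for s
    using lcoeff_gb_elem[OF L[OF that]] by (metis lcoeff_eq_0_iff zero_neq_one)
  then have G: "reduced_gb n w I \<subseteq> I - {0}"
    using L gb_elem_in_ideal by (auto simp: gb)
  have min: "min_elems L \<subseteq> lmon w ` reduced_gb n w I"
    using L lmon_gb_elem by (force simp: gb)
  have "finite (reduced_gb n w I)"
    unfolding gb using finite_min_elems[of "{1..n}" L] lead_mons_subset by simp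
  then obtain r where "is_remainder n w (reduced_gb n w I) f r"
    using ex_remainder[OF _ G assms] by blast
  with remainder_eq_nf[OF G _ min] show ?thesis
    unfolding remainder_def by (metis (no_types, lifting) the_equality)
qed

end

section \<open>Graded free modules over polynomial rings\<close>

text \<open>The two factors use disjoint sets of variables, so each exponent of the product belongs
  to exactly one of them.\<close>

lemma mons_split_unique:
  assumes "u \<in> mons (V - T)" "u' \<in> mons (V - T)" "M \<in> mons T" "M' \<in> mons T"
    and eq: "u + M = u' + M'"
  shows "u = u' \<and> M = M'"
proof -
  have 0: "lookup u i = 0 \<and> lookup u' i = 0" if "i \<in> T" for i
    using assms(1,2) that by (auto simp: mons_def in_keys_iff)
  have 1: "lookup M i = 0 \<and> lookup M' i = 0" if "i \<notin> T" for i
    using assms(3,4) that by (auto simp: mons_def in_keys_iff)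
  have "lookup u i + lookup M i = lookup u' i + lookup M' i" for i
    using eq by (metis lookup_add)
  with 0 1 have "lookup u i = lookup u' i \<and> lookup M i = lookup M' i" for i
    by (metis add_cancel_left_left add_cancel_right_right)
  then show ?thesis
    by (auto intro: poly_mapping_eqI)
qed

lemma mons_split:
  assumes "m \<in> mons V"
  obtains u M where "m = u + M" "u \<in> mons (V - T)" "M \<in> mons T"
proof
  let ?s = "\<lambda>i. Poly_Mapping.single i (lookup m i)"
  have "m = sum ?s (keys m)"
    by (simp add: sum_single_lookup)
  also have "\<dots> = sum ?s (keys m \<inter> T) + sum ?s (keys m - T)"
    by (rule sum.Int_Diff) simp
  finally show "m = sum ?s (keys m - T) + sum ?s (keys m \<inter> T)"
    by (simp add: add.commute)
  have keys: "keys (?s i) = {i}" if "i \<in> keys m" for i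
    using that by (simp add: in_keys_iff)
  show "sum ?s (keys m - T) \<in> mons (V - T)"
    using keys_sum_subset[of ?s "keys m - T"] keys assms by (auto simp: mons_def)
  show "sum ?s (keys m \<inter> T) \<in> mons T"
    using keys_sum_subset[of ?s "keys m \<inter> T"] keys by (auto simp: mons_def)
qed

lemma free_module_simps [simp]:
  "g \<in> carrier (free_module (pring V) B) \<longleftrightarrow> keys g \<subseteq> B \<and> (\<forall>v. keys (lookup g v) \<subseteq> mons V)"
  "g \<oplus>\<^bsub>free_module A B\<^esub> h = g + h" "\<zero>\<^bsub>free_module A B\<^esub> = 0"
  by (simp_all add: free_module_def)

lemma lookup_smult_free_module [simp]:
  "lookup (a \<odot>\<^bsub>free_module A B\<^esub> g) v = a * lookup g v"
  by (simp add: free_module_def map.rep_eq when_def)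

lemma keys_smult_free_module: "keys (a \<odot>\<^bsub>free_module A B\<^esub> g) \<subseteq> keys g"
  by (auto simp: in_keys_iff)

lemma abelian_group_free_module: "abelian_group (free_module (pring V) B :: ('k::field mpol, 'k fmod) module)"
proof (rule abelian_groupI)
  fix x :: "'k fmod" assume "x \<in> carrier (free_module (pring V) B)"
  then show "\<exists>y\<in>carrier (free_module (pring V) B). y \<oplus>\<^bsub>free_module (pring V) B\<^esub> x
      = \<zero>\<^bsub>free_module (pring V) B\<^esub>"
    by (intro bexI[of _ "- x"]) simp_all
next
  fix x y :: "'k fmod"
  assume "x \<in> carrier (free_module (pring V) B)" "y \<in> carrier (free_module (pring V) B)"
  then show "x \<oplus>\<^bsub>free_module (pring V) B\<^esub> y \<in> carrier (free_module (pring V) B)"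
    using order_trans[OF keys_add[of x y]] keys_add_mons[of "lookup x _" V "lookup y _"]
    by (simp add: lookup_add)
qed (auto simp: add.assoc add.commute)

lemma submodule_free_moduleI:
  fixes N :: "'k::field fmod set"
  assumes N: "N \<subseteq> carrier (free_module (pring V) B)" "0 \<in> N" "\<And>x y. x \<in> N \<Longrightarrow> y \<in> N \<Longrightarrow> x + y \<in> N"
    and smult: "\<And>a x. keys a \<subseteq> mons V \<Longrightarrow> x \<in> N \<Longrightarrow> a \<odot>\<^bsub>free_module (pring V) B\<^esub> x \<in> N"
  shows "submodule N (pring V) (free_module (pring V) B)"
proof -
  interpret abelian_group "free_module (pring V) B :: ('k mpol, 'k fmod) module"
    by (rule abelian_group_free_module)
  have "subgroup N (add_monoid (free_module (pring V) B))"
  proof (rule group.subgroupI[OF a_group])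
    fix x assume x: "x \<in> N"
    have "(- 1) \<odot>\<^bsub>free_module (pring V) B\<^esub> x = - x"
      by (rule poly_mapping_eqI) simp
    then have "- x \<in> N"
      using smult[of "- 1" x] x by simp
    moreover have "\<ominus>\<^bsub>free_module (pring V) B\<^esub> x = - x"
      by (rule minus_equality) (use subsetD[OF N(1) x] in simp_all)
    ultimately show "inv\<^bsub>add_monoid (free_module (pring V) B)\<^esub> x \<in> N"
      by (simp only: a_inv_def)
  qed (use N in auto)
  then show ?thesis
    by (rule submodule.intro) (simp add: submodule_axioms_def smult)
qed

lemma gen_submodule_mono: "S \<subseteq> S' \<Longrightarrow> gen_submodule A F S \<subseteq> gen_submodule A F S'"
  unfolding gen_submodule_def by blast

lemma gen_submodule_least: "submodule N A F \<Longrightarrow> S \<subseteq> N \<Longrightarrow> gen_submodule A F S \<subseteq> N"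
  unfolding gen_submodule_def by blast

lemma mod_keys_single: "mod_keys (Poly_Mapping.single u p) = (\<lambda>M. (M, u)) ` keys p"
  by (auto simp: mod_keys_def lookup_single when_def split: if_splits)

lemma mod_keys_add: "mod_keys (g + h) \<subseteq> mod_keys g \<union> mod_keys h"
  using keys_add by (fastforce simp: mod_keys_def lookup_add)

text \<open>Encloses the submodule generated by the module monomials in \<open>P\<close>, and so
  certifies that a monomial is not in it. Divisibility is required within the same component
  \<open>u\<close>.\<close>

lemma submodule_mod_monomials:
  fixes P :: "(mon \<times> mon) set" and V :: "nat set" and B :: "mon set"
  defines "N \<equiv> {g :: 'k::field fmod. g \<in> carrier (free_module (pring V) B) \<and>
    (\<forall>(M, u)\<in>mod_keys g. \<exists>M'. (M', u) \<in> P \<and> mon_dvd M' M)}"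
  shows "submodule N (pring V) (free_module (pring V) B)"
proof (rule submodule_free_moduleI)
  interpret abelian_group "free_module (pring V) B :: ('k mpol, 'k fmod) module"
    by (rule abelian_group_free_module)
  show "0 \<in> N"
    by (simp add: N_def mod_keys_def)
  show "x + y \<in> N" if "x \<in> N" "y \<in> N" for x y
    using that a_closed[of x y] mod_keys_add[of x y] unfolding N_def by auto
  fix a :: "'k mpol" and x assume a: "keys a \<subseteq> mons V" and x: "x \<in> N"
  have "\<exists>M'. (M', u) \<in> P \<and> mon_dvd M' M"
    if M: "(M, u) \<in> mod_keys (a \<odot>\<^bsub>free_module (pring V) B\<^esub> x)" for M u
  proof -
    obtain s t where st: "M = s + t" "(t, u) \<in> mod_keys x"
      using M keys_mult[of a "lookup x u"] by (auto simp: mod_keys_def)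
    then obtain M' where "(M', u) \<in> P" "mon_dvd M' t"
      using x by (auto simp: N_def)
    then show ?thesis
      using st(1) mon_dvd_trans mon_dvd_add(2) by blast
  qed
  moreover have "a \<odot>\<^bsub>free_module (pring V) B\<^esub> x \<in> carrier (free_module (pring V) B)"
    using a x order_trans[OF keys_smult_free_module[of _ B a x]] keys_mult_mons[of a V "lookup x _"]
    by (simp add: N_def)
  ultimately show "a \<odot>\<^bsub>free_module (pring V) B\<^esub> x \<in> N"
    unfolding N_def by blast
qed (auto simp: N_def)

section \<open>Evaluating module elements as polynomials\<close>

lemma lin_comb_eq_sum:
  assumes "finite S" "keys g \<subseteq> S"
  shows "lin_comb g = (\<Sum>v\<in>S. lookup g v * xmon v)"
  unfolding lin_comb_def using assms by (intro sum.mono_neutral_left) (auto simp: in_keys_iff)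

lemma lin_comb_single: "lin_comb (Poly_Mapping.single u p) = p * xmon u"
  using lin_comb_eq_sum[of "{u}" "Poly_Mapping.single u p"] by simp

lemma lin_comb_add: "lin_comb (g + h) = lin_comb g + lin_comb h"
proof -
  have eq: "lin_comb f = (\<Sum>v\<in>keys g \<union> keys h. lookup f v * xmon v)"
    if "keys f \<subseteq> keys g \<union> keys h" for f
    using that by (intro lin_comb_eq_sum) auto
  show ?thesis
    using eq[of g] eq[of h] eq[of "g + h"] keys_add[of g h]
    by (simp add: lookup_add distrib_right sum.distrib)
qed

lemma lin_comb_smult: "lin_comb (a \<odot>\<^bsub>free_module A B\<^esub> g) = a * lin_comb g"
  using keys_smult_free_module[of A B a g]
  by (simp add: lin_comb_eq_sum[of "keys g"] sum_distrib_left mult.assoc)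

lemma lin_comb_minus: "lin_comb (g - h) = lin_comb g - lin_comb h"
  using lin_comb_add[of "g - h" h] by simp

text \<open>Distinct module monomials have distinct products by \<open>mons_split_unique\<close>.
  Nothing cancels in the evaluation, and coefficients can be read off from it.\<close>

lemma
  fixes g :: "'k::field fmod"
  assumes g: "keys g \<subseteq> mons (V - T)" "\<And>v. keys (lookup g v) \<subseteq> mons T"
  shows keys_lin_comb: "keys (lin_comb g) = (\<lambda>(M, u). u + M) ` mod_keys g"
    and lookup_lin_comb:
      "u \<in> mons (V - T) \<Longrightarrow> M \<in> mons T \<Longrightarrow> lookup (lin_comb g) (u + M) = lookup (lookup g u) M"
proof -
  have lookup: "lookup (lin_comb g) (u + M) = lookup (lookup g u) M"
    if u: "u \<in> mons (V - T)" and M: "M \<in> mons T" for u M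
  proof -
    have "lookup (lookup g v * xmon v) (u + M) = (if v = u then lookup (lookup g u) M else 0)"
      if v: "v \<in> keys g" for v
    proof (cases "v = u")
      case True
      then show ?thesis
        using lookup_mult_single[of "lookup g u" u 1 M] by (simp add: xmon_def add.commute)
    next
      case False
      have "u + M \<notin> keys (lookup g v * xmon v)"
      proof
        assume "u + M \<in> keys (lookup g v * xmon v)"
        then obtain M' where M': "M' \<in> keys (lookup g v)" "u + M = v + M'"
          by (auto simp: xmon_def keys_mult_single add.commute)
        have "v \<in> mons (V - T)" "M' \<in> mons T"
          using M'(1) v g by blast+
        then show False
          using mons_split_unique[OF u _ M _ M'(2)] False by blast
      qed
      with False show ?thesis
        by (simp add: in_keys_iff)
    qed
    then have "lookup (lin_comb g) (u + M) = (\<Sum>v\<in>keys g. if v = u then lookup (lookup g u) M else 0)"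
      unfolding lin_comb_def lookup_sum by (intro sum.cong) auto
    also have "\<dots> = lookup (lookup g u) M"
      by (simp add: in_keys_iff)
    finally show ?thesis .
  qed
  then show "u \<in> mons (V - T) \<Longrightarrow> M \<in> mons T \<Longrightarrow> lookup (lin_comb g) (u + M) = lookup (lookup g u) M" .
  show "keys (lin_comb g) = (\<lambda>(M, u). u + M) ` mod_keys g"
  proof
    show "keys (lin_comb g) \<subseteq> (\<lambda>(M, u). u + M) ` mod_keys g"
    proof
      fix m assume "m \<in> keys (lin_comb g)"
      then obtain v where "m \<in> keys (lookup g v * xmon v)"
        using keys_sum_subset[of "\<lambda>v. lookup g v * xmon v" "keys g"] by (auto simp: lin_comb_def)
      then obtain M where "M \<in> keys (lookup g v)" "m = v + M"
        by (auto simp: xmon_def keys_mult_single add.commute)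
      then show "m \<in> (\<lambda>(M, u). u + M) ` mod_keys g"
        by (auto simp: mod_keys_def)
    qed
    show "(\<lambda>(M, u). u + M) ` mod_keys g \<subseteq> keys (lin_comb g)"
    proof clarify
      fix M u assume "(M, u) \<in> mod_keys g"
      then have Mu: "lookup (lookup g u) M \<noteq> 0"
        by (simp add: mod_keys_def in_keys_iff)
      then have "u \<in> keys g" "M \<in> keys (lookup g u)"
        by (auto simp: in_keys_iff)
      then have "u \<in> mons (V - T)" "M \<in> mons T"
        using g by blast+
      then show "u + M \<in> keys (lin_comb g)"
        using lookup Mu by (simp add: in_keys_iff)
    qed
  qed
qed

section \<open>Finiteness from Noether normalization\<close>

lemma xvar_power: "(xvar i :: 'k::field mpol) ^ k = xmon (Poly_Mapping.single i k)"
proof (induction k)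
  case 0
  show ?case by (simp add: xmon_def)
next
  case (Suc k)
  have eq: "Poly_Mapping.single i (Suc k) = Poly_Mapping.single i 1 + Poly_Mapping.single i k"
    by (simp add: single_add[symmetric])
  have "xvar i ^ Suc k = xvar i * (xmon (Poly_Mapping.single i k) :: 'k mpol)"
    by (simp add: Suc.IH)
  then show ?case
    by (simp only: eq xmon_add xvar_def)
qed

lemma nat_pow_pring: "x [^]\<^bsub>pring V\<^esub> (k :: nat) = x ^ k"
  by (induction k) (simp_all add: nat_pow_def pring_def mult.commute)

lemma finsum_pring:
  fixes f :: "'i \<Rightarrow> 'k::field mpol"
  assumes "finite S" "\<And>i. i \<in> S \<Longrightarrow> keys (f i) \<subseteq> mons V"
  shows "(\<Oplus>\<^bsub>pring V\<^esub>i\<in>S. f i) = (\<Sum>i\<in>S. f i)"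
proof -
  interpret cring "pring V :: 'k mpol ring" by (rule cring_pring)
  show ?thesis
    using assms by (induction S) (auto simp: finsum_insert)
qed

lemma lookup_hom_component: "lookup (hom_component w e f) m = (if wdeg w m = e then lookup f m else 0)"
proof -
  have "lookup (hom_component w e f) m
      = (\<Sum>k\<in>{m \<in> keys f. wdeg w m = e}. if k = m then lookup f m else 0)"
    unfolding hom_component_def lookup_sum by (intro sum.cong) (auto simp: lookup_single)
  then show ?thesis
    by (auto simp: in_keys_iff)
qed

lemma wdeg_single: "wdeg w (Poly_Mapping.single i k) = w i * k"
  using wdeg_eq_sum[of "{i}" "Poly_Mapping.single i k" w] by simp

text \<open>Each coefficient of the integral equation has a representative in \<open>A\<close>.
  Since the quotient map is a ring homomorphism, the equation says that the lifted polynomial has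
  the coset of zero.\<close>

lemma integral_elem_imp_relation:
  fixes x :: "'k::field mpol"
  assumes I: "ideal I (pring V)" and x: "keys x \<subseteq> mons V"
    and A: "\<And>a. a \<in> A \<Longrightarrow> keys a \<subseteq> mons V"
    and int: "integral_elem (pring V Quot I) ((\<lambda>a. I +>\<^bsub>pring V\<^esub> a) ` A) (I +>\<^bsub>pring V\<^esub> x)"
  shows "\<exists>k a. (\<forall>j<k. a j \<in> A) \<and> x ^ k + (\<Sum>j<k. a j * x ^ j) \<in> I"
proof -
  define h where "h = (+>\<^bsub>pring V\<^esub>) I"
  let ?Q = "pring V Quot I"
  interpret ring_hom_cring "pring V" ?Q h
    unfolding h_def using ideal.rcos_ring_hom_cring[OF I cring_pring] by simp
  have hom_pow: "h (p ^ k) = h p [^]\<^bsub>?Q\<^esub> k" if "keys p \<subseteq> mons V" for p and k :: nat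
    using ring_hom_ring.hom_nat_pow[OF ideal.rcos_ring_hom_ring[OF I], of p k] that by (simp add: nat_pow_pring h_def)
  obtain k :: nat and c where c: "\<forall>j<k. c j \<in> h ` A"
    and eq: "h x [^]\<^bsub>?Q\<^esub> k \<oplus>\<^bsub>?Q\<^esub> (\<Oplus>\<^bsub>?Q\<^esub>j\<in>{..<k}. c j \<otimes>\<^bsub>?Q\<^esub> h x [^]\<^bsub>?Q\<^esub> j) = \<zero>\<^bsub>?Q\<^esub>"
    using int[folded h_def] unfolding integral_elem_def by blast
  have "\<forall>j. \<exists>a. j < k \<longrightarrow> a \<in> A \<and> c j = h a"
    using c by blast
  then obtain a where a: "\<And>j. j < k \<Longrightarrow> a j \<in> A" "\<And>j. j < k \<Longrightarrow> c j = h (a j)"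
    by metis
  have pow: "keys (x ^ j) \<subseteq> mons V" for j
    using x R.nat_pow_closed[of x j] by (simp add: nat_pow_pring)
  have summand: "keys (a j * x ^ j) \<subseteq> mons V" if "j < k" for j
    using A a(1) that pow by (intro keys_mult_mons) auto
  have sum: "keys (\<Sum>j<k. a j * x ^ j) \<subseteq> mons V"
    using keys_sum_subset[of "\<lambda>j. a j * x ^ j" "{..<k}"] summand by blast
  have finsum: "(\<Oplus>\<^bsub>pring V\<^esub>j\<in>{..<k}. a j * x ^ j) = (\<Sum>j<k. a j * x ^ j)"
    by (rule finsum_pring) (use summand in auto)
  have "h (\<Sum>j<k. a j * x ^ j) = (\<Oplus>\<^bsub>?Q\<^esub>j\<in>{..<k}. h (a j * x ^ j))"
    using summand hom_finsum[of "\<lambda>j. a j * x ^ j" "{..<k}"] unfolding finsum by (simp add: o_def Pi_def)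
  also have "\<dots> = (\<Oplus>\<^bsub>?Q\<^esub>j\<in>{..<k}. c j \<otimes>\<^bsub>?Q\<^esub> h x [^]\<^bsub>?Q\<^esub> j)"
  proof (rule S.finsum_cong')
    show "(\<lambda>j. c j \<otimes>\<^bsub>?Q\<^esub> h x [^]\<^bsub>?Q\<^esub> j) \<in> {..<k} \<rightarrow> carrier ?Q"
      using a A x by (auto intro!: S.m_closed S.nat_pow_closed hom_closed)
    fix j assume j: "j \<in> {..<k}"
    show "h (a j * x ^ j) = c j \<otimes>\<^bsub>?Q\<^esub> h x [^]\<^bsub>?Q\<^esub> j"
      using hom_mult[of "a j" "x ^ j"] a[of j] A j pow hom_pow[OF x] by simp
  qed simp
  finally have "h (x ^ k + (\<Sum>j<k. a j * x ^ j)) = \<zero>\<^bsub>?Q\<^esub>"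
    using hom_add[of "x ^ k" "\<Sum>j<k. a j * x ^ j"] pow sum eq hom_pow[OF x] by simp
  then have "I +>\<^bsub>pring V\<^esub> (x ^ k + (\<Sum>j<k. a j * x ^ j)) = I"
    by (simp add: h_def FactRing_def)
  moreover have "keys (x ^ k + (\<Sum>j<k. a j * x ^ j)) \<subseteq> mons V"
    using pow sum by (rule keys_add_mons)
  ultimately show ?thesis
    using a(1) rcoset_pring_eq_iff[OF I] by blast
qed

section \<open>The ideal together with its Noether normalization\<close>

locale noether_setting = weighted_ideal n w I
  for n :: nat and w :: "nat \<Rightarrow> nat" and I :: "('k::field) mpol set" +
  fixes d :: nat
  assumes noether: "is_noether_normalization (pring {1..n}) I (noether_ring n d)"
begin

abbreviation T :: "nat set" where
  "T \<equiv> tail_vars n d"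

lemma tail_subset: "T \<subseteq> {1..n}"
  by (auto simp: tail_vars_def)

lemma head_less_tail: "i \<in> {1..n} - T \<Longrightarrow> j \<in> T \<Longrightarrow> i < j"
  by (auto simp: tail_vars_def)

lemma mons_tail: "M \<in> mons T \<Longrightarrow> M \<in> mons {1..n}"
  using mons_mono[OF tail_subset] by blast

lemma mons_head: "u \<in> mons ({1..n} - T) \<Longrightarrow> u \<in> mons {1..n}"
  using mons_mono[of "{1..n} - T" "{1..n}"] by blast

text \<open>Both summands are monomial ideals, so a monomial lies in their sum only if it lies in
  one of them.\<close>

lemma B0_eq: "B0 n d w I = mons ({1..n} - T) - L"
proof -
  let ?X = "Idl\<^bsub>pring {1..n}\<^esub> (xvar ` T) :: 'k mpol set"
  have "(xvar ` T :: 'k mpol set) = xmon ` (\<lambda>i. Poly_Mapping.single i 1) ` T"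
    by (simp add: xvar_def[abs_def] image_image)
  moreover have "(\<lambda>i. Poly_Mapping.single i 1) ` T \<subseteq> mons {1..n}"
    using tail_subset by (auto simp: mons_def)
  moreover have "mon_dvd (Poly_Mapping.single i 1) m \<longleftrightarrow> i \<in> keys m" for i m
    by (auto simp: mon_dvd_iff lookup_single when_def in_keys_iff Suc_le_eq)
  ultimately have X: "?X = {p. keys p \<subseteq> mons {1..n} \<and> (\<forall>m\<in>keys p. keys m \<inter> T \<noteq> {})}"
    by (simp add: Idl_xmon_eq) blast
  have "xmon m \<in> init_ideal n w I <+>\<^bsub>pring {1..n}\<^esub> ?X \<longleftrightarrow> m \<in> L \<or> keys m \<inter> T \<noteq> {}"
    if m: "m \<in> mons {1..n}" for m
  proof
    assume "xmon m \<in> init_ideal n w I <+>\<^bsub>pring {1..n}\<^esub> ?X"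
    then obtain a b where ab: "xmon m = a + b" "a \<in> init_ideal n w I" "b \<in> ?X"
      by (auto simp: set_add_def')
    then have "m \<in> keys a \<or> m \<in> keys b"
      using keys_add[of a b] keys_xmon[of m, where 'k = 'k] by auto
    then show "m \<in> L \<or> keys m \<inter> T \<noteq> {}"
      using ab(2,3) unfolding init_ideal_eq X by blast
  next
    assume "m \<in> L \<or> keys m \<inter> T \<noteq> {}"
    then have "xmon m \<in> init_ideal n w I \<and> 0 \<in> ?X \<or> 0 \<in> init_ideal n w I \<and> xmon m \<in> ?X"
      using m unfolding init_ideal_eq X by auto
    then show "xmon m \<in> init_ideal n w I <+>\<^bsub>pring {1..n}\<^esub> ?X"
      unfolding set_add_def' by force
  qed
  then have "B0 n d w I = {m \<in> mons {1..n}. \<not> (m \<in> L \<or> keys m \<inter> T \<noteq> {})}"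
    unfolding B0_def by blast
  then show ?thesis
    by (auto simp: mons_def)
qed

text \<open>
  In an integral equation of \<open>x\<^sub>i\<close> over \<open>A\<close>, made homogeneous, every term other than the power of
  \<open>x\<^sub>i\<close> involves a variable of \<open>A\<close>, so the power of \<open>x\<^sub>i\<close> is the initial term.
\<close>

lemma ex_power_in_lead_mons:
  assumes hom: "homogeneous_set w I" and i: "i \<in> {1..n} - T"
  shows "\<exists>k. Poly_Mapping.single i k \<in> L"
proof -
  have x: "keys (xvar i :: 'k mpol) \<subseteq> mons {1..n}"
    using i by (auto simp: xvar_def mons_def)
  have "I +>\<^bsub>pring {1..n}\<^esub> xvar i \<in> carrier (pring {1..n} Quot I)"
    using x by (auto simp: FactRing_def A_RCOSETS_def')
  then have int: "integral_elem (pring {1..n} Quot I)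
      ((\<lambda>a. I +>\<^bsub>pring {1..n}\<^esub> a) ` carrier (noether_ring n d)) (I +>\<^bsub>pring {1..n}\<^esub> xvar i)"
    using noether unfolding is_noether_normalization_def by blast
  have A: "keys a \<subseteq> mons {1..n}" if "a \<in> carrier (noether_ring n d)" for a :: "'k mpol"
    using that mons_tail by auto
  obtain k a where a: "\<forall>j<k. a j \<in> carrier (noether_ring n d)"
    and p: "xvar i ^ k + (\<Sum>j<k. a j * xvar i ^ j) \<in> I"
    using integral_elem_imp_relation[OF ideal_I x A int] by blast
  let ?x = "Poly_Mapping.single i k"
  define q where "q = (\<Sum>j<k. a j * xmon (Poly_Mapping.single i j))"
  define f where "f = hom_component w (w i * k) (xmon ?x + q)"
  have "f \<in> I"
    using hom p unfolding homogeneous_set_def f_def q_def by (simp add: xvar_power)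
  have q: "\<exists>j<k. \<exists>t\<in>mons T. m = t + Poly_Mapping.single i j" if m: "m \<in> keys q" for m
  proof -
    obtain j where j: "j < k" "m \<in> keys (a j * xmon (Poly_Mapping.single i j))"
      using m keys_sum_subset[of "\<lambda>j. a j * xmon (Poly_Mapping.single i j)" "{..<k}"]
      by (auto simp: q_def)
    then obtain t where "t \<in> keys (a j)" "m = t + Poly_Mapping.single i j"
      by (auto simp: xmon_def keys_mult_single)
    moreover have "keys (a j) \<subseteq> mons T"
      using a j(1) by simp
    ultimately show ?thesis
      using j(1) by blast
  qed
  \<comment> \<open>Elements of A do not involve the variable of index \<open>i\<close>, so
    monomials of \<open>q\<close> have exponent \<open>j < k\<close> there and cannot cancel the
    pure power.\<close>
  have "?x \<notin> keys q"
  proof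
    assume "?x \<in> keys q"
    then obtain j t where j: "j < k" "t \<in> mons T" "?x = t + Poly_Mapping.single i j"
      using q by blast
    then have "lookup ?x i = lookup t i + j"
      by (simp add: lookup_add)
    moreover have "lookup t i = 0"
      using j(2) i by (auto simp: mons_def in_keys_iff)
    ultimately show False
      using j(1) by simp
  qed
  then have x_key: "?x \<in> keys f"
    by (simp add: in_keys_iff f_def lookup_hom_component wdeg_single lookup_add lookup_xmon)
  have "wle w m ?x" if m: "m \<in> keys f" for m
  proof (cases "m = ?x")
    case False
    then have deg: "wdeg w m = w i * k" and "m \<in> keys q"
      using m by (auto simp: in_keys_iff f_def lookup_hom_component lookup_add lookup_xmon split: if_splits)
    then obtain j t where j: "j < k" "t \<in> mons T" "m = t + Poly_Mapping.single i j"
      using q by blast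
    have "w i * j < w i * k"
      using j(1) i weights_pos by simp
    then have "t \<noteq> 0"
      using deg by (auto simp: j(3) wdeg_add wdeg_single)
    \<comment> \<open>The index \<open>l\<close> is the last variable of \<open>m\<close>: it comes
      from A and therefore exceeds \<open>i\<close>. There \<open>m\<close> has a positive exponent
      and \<open>?x\<close> has none, so at equal degree \<open>m\<close> is the smaller
      one.\<close>
    define l where "l = Max (keys t)"
    have l: "l \<in> keys t"
      unfolding l_def using \<open>t \<noteq> 0\<close> by (intro Max_in) auto
    then have il: "i < l"
      using j(2) head_less_tail[OF i] by (auto simp: mons_def)
    have "lookup m b = 0" if "l < b" for b
    proof -
      have "b \<notin> keys t"
      proof
        assume "b \<in> keys t"
        then have "b \<le> l"
          by (simp add: l_def)
        with that show False by simp
      qed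
      then show ?thesis
        using that il by (simp add: j(3) lookup_add lookup_single in_keys_iff)
    qed
    moreover have "0 < lookup m l"
      using l by (simp add: j(3) lookup_add in_keys_iff)
    ultimately have "wrevlex w ?x m"
      using il by (auto simp: wrevlex_def deg wdeg_single lookup_single when_def intro!: exI[of _ l])
    then show ?thesis
      by (simp add: wle_iff)
  qed simp
  then have "lmon w f = ?x"
    using x_key by (intro lmon_eqI)
  moreover have "f \<noteq> 0"
    using x_key by auto
  ultimately have "lmon w f \<in> L" "lmon w f = ?x"
    using \<open>f \<in> I\<close> unfolding lead_mons_def by blast+
  then show ?thesis
    by (intro exI[of _ k]) simp
qed

text \<open>A pure power of each variable outside A lies in \<open>L\<close>. This bounds every
  exponent of a monomial in \<open>B0\<close>, hence its degree.\<close>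

lemma finite_B0:
  assumes "homogeneous_set w I"
  shows "finite (B0 n d w I)"
proof -
  have "\<forall>i. \<exists>k. i \<in> {1..n} - T \<longrightarrow> Poly_Mapping.single i k \<in> L"
    using ex_power_in_lead_mons[OF assms] by blast
  then obtain N where N: "\<And>i. i \<in> {1..n} - T \<Longrightarrow> Poly_Mapping.single i (N i) \<in> L"
    by metis
  have "wdeg w u \<le> (\<Sum>i\<in>{1..n}. w i * N i)" if u: "u \<in> B0 n d w I" for u
  proof -
    have uH: "u \<in> mons ({1..n} - T)" and uL: "u \<notin> L"
      using u by (auto simp: B0_eq)
    have "lookup u i \<le> N i" if "i \<in> {1..n}" for i
    proof (cases "i \<in> T")
      case True
      then have "lookup u i = 0"
        using uH by (auto simp: mons_def in_keys_iff)
      then show ?thesis by simp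
    next
      case False
      show ?thesis
      proof (rule ccontr)
        assume "\<not> lookup u i \<le> N i"
        then have "mon_dvd (Poly_Mapping.single i (N i)) u"
          by (auto simp: mon_dvd_iff lookup_single when_def)
        moreover have "Poly_Mapping.single i (N i) \<in> L"
          using N False that by blast
        ultimately show False
          using uL mons_head[OF uH] lead_mons_dvd_closed by blast
      qed
    qed
    then have "(\<Sum>i\<in>{1..n}. w i * lookup u i) \<le> (\<Sum>i\<in>{1..n}. w i * N i)"
      by (intro sum_mono mult_left_mono) auto
    then show ?thesis
      using wdeg_eq_sum[of "{1..n}" u w] mons_head[OF uH] by (simp add: mons_def)
  qed
  then have "B0 n d w I \<subseteq> {m \<in> mons {1..n}. wdeg w m \<le> (\<Sum>i\<in>{1..n}. w i * N i)}"
    using mons_head by (auto simp: B0_eq)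
  then show ?thesis
    using finite_wdeg_le finite_subset by blast
qed

section \<open>The kernel and its initial terms\<close>

lemma carrier_F0 [simp]:
  "g \<in> carrier (F0 n d w I) \<longleftrightarrow> keys g \<subseteq> B0 n d w I \<and> (\<forall>v. keys (lookup g v) \<subseteq> mons T)"
  by (simp add: F0_def)

lemma
  assumes "g \<in> carrier (F0 n d w I)"
  shows keys_lin_comb_F0: "keys (lin_comb g) = (\<lambda>(M, u). u + M) ` mod_keys g"
    and lookup_lin_comb_F0:
      "u \<in> mons ({1..n} - T) \<Longrightarrow> M \<in> mons T \<Longrightarrow> lookup (lin_comb g) (u + M) = lookup (lookup g u) M"
    and lin_comb_in_mons: "keys (lin_comb g) \<subseteq> mons {1..n}"
    and mod_keys_F0: "(M, u) \<in> mod_keys g \<Longrightarrow> u \<in> mons ({1..n} - T) \<and> u \<notin> L \<and> M \<in> mons T"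
proof -
  have g: "keys g \<subseteq> mons ({1..n} - T)" "\<And>v. keys (lookup g v) \<subseteq> mons T"
    using assms by (auto simp: B0_eq)
  show keys: "keys (lin_comb g) = (\<lambda>(M, u). u + M) ` mod_keys g"
    by (rule keys_lin_comb[OF g])
  show "u \<in> mons ({1..n} - T) \<Longrightarrow> M \<in> mons T \<Longrightarrow> lookup (lin_comb g) (u + M) = lookup (lookup g u) M"
    by (rule lookup_lin_comb[OF g])
  show mod: "u \<in> mons ({1..n} - T) \<and> u \<notin> L \<and> M \<in> mons T" if "(M, u) \<in> mod_keys g" for M u
  proof -
    have M: "M \<in> keys (lookup g u)"
      using that by (simp add: mod_keys_def)
    then have "u \<in> keys g"
      by (auto simp: in_keys_iff)
    then have "u \<in> B0 n d w I"
      using assms by auto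
    then show ?thesis
      using M g(2) by (auto simp: B0_eq)
  qed
  show "keys (lin_comb g) \<subseteq> mons {1..n}"
    unfolding keys using mod mons_head mons_tail by auto
qed

lemma lin_comb_inj:
  assumes "g \<in> carrier (F0 n d w I)" "g' \<in> carrier (F0 n d w I)" "lin_comb g = lin_comb g'"
  shows "g = g'"
proof (rule poly_mapping_eqI, rule poly_mapping_eqI)
  fix u M
  show "lookup (lookup g u) M = lookup (lookup g' u) M"
  proof (cases "u \<in> mons ({1..n} - T) \<and> M \<in> mons T")
    case True
    then show ?thesis
      using lookup_lin_comb_F0[OF assms(1)] lookup_lin_comb_F0[OF assms(2)] assms(3) by metis
  next
    case False
    then have "(M, u) \<notin> mod_keys g" "(M, u) \<notin> mod_keys g'"
      using mod_keys_F0 assms by blast+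
    then show ?thesis
      by (simp add: mod_keys_def in_keys_iff)
  qed
qed

lemma F0_closed:
  assumes "g \<in> carrier (F0 n d w I)" "g' \<in> carrier (F0 n d w I)"
  shows "g + g' \<in> carrier (F0 n d w I)" "g - g' \<in> carrier (F0 n d w I)"
proof -
  have "keys (g + g') \<subseteq> B0 n d w I" "keys (g - g') \<subseteq> B0 n d w I"
    using assms keys_add[of g g'] keys_minus_subset[of g g'] by auto
  then show "g + g' \<in> carrier (F0 n d w I)" "g - g' \<in> carrier (F0 n d w I)"
    using assms keys_add_mons[of "lookup g _" T] keys_minus_mons[of "lookup g _" T]
    by (simp_all add: lookup_add lookup_minus)
qed

lemma single_in_F0:
  "u \<in> B0 n d w I \<Longrightarrow> keys p \<subseteq> mons T \<Longrightarrow> Poly_Mapping.single u p \<in> carrier (F0 n d w I)"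
  by (auto simp: lookup_single when_def)

lemma zero_in_F0: "0 \<in> carrier (F0 n d w I)"
  by simp

text \<open>The part of a monomial free of the variables of A divides it. If the monomial is outside
  \<open>L\<close>, so is that part, which is then an element of \<open>B0\<close>.\<close>

lemma ex_lin_comb_eq:
  assumes "keys p \<subseteq> mons {1..n} - L"
  shows "\<exists>g\<in>carrier (F0 n d w I). lin_comb g = p"
proof -
  have "\<exists>g\<in>carrier (F0 n d w I). lin_comb g = (\<Sum>m\<in>S. Poly_Mapping.single m (lookup p m))"
    if "finite S" "S \<subseteq> keys p" for S
    using that
  proof (induction S)
    case empty
    then show ?case
      using zero_in_F0 by (intro bexI[of _ 0]) (simp_all add: lin_comb_def)
  next
    case (insert m S)
    then obtain g where g: "g \<in> carrier (F0 n d w I)"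
      "lin_comb g = (\<Sum>m\<in>S. Poly_Mapping.single m (lookup p m))"
      by auto
    have m: "m \<in> mons {1..n}" "m \<notin> L"
      using insert.prems assms by auto
    obtain u M where uM: "m = u + M" "u \<in> mons ({1..n} - T)" "M \<in> mons T"
      using m(1) by (rule mons_split)
    have "u \<notin> L"
      using m lead_mons_dvd_closed[of u m] by (auto simp: uM(1))
    then have "u \<in> B0 n d w I"
      using uM(2) by (simp add: B0_eq)
    define h where "h = Poly_Mapping.single u (Poly_Mapping.single M (lookup p m))"
    have "h \<in> carrier (F0 n d w I)"
      unfolding h_def using \<open>u \<in> B0 n d w I\<close> uM(3) by (intro single_in_F0) auto
    moreover have "lin_comb h = Poly_Mapping.single m (lookup p m)"
      by (simp add: h_def lin_comb_single xmon_def mult_single uM(1) add.commute)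
    ultimately show ?case
      using g insert.hyps F0_closed(1)[of h g]
      by (intro bexI[of _ "h + g"]) (simp_all add: lin_comb_add)
  qed
  from this[of "keys p"] show ?thesis
    by (simp add: sum_single_lookup)
qed

lemma ker_psi0_eq: "ker_psi0 n d w I = {g \<in> carrier (F0 n d w I). lin_comb g \<in> I}"
proof -
  have "psi0 n I g = \<zero>\<^bsub>pring {1..n} Quot I\<^esub> \<longleftrightarrow> lin_comb g \<in> I"
    if "g \<in> carrier (F0 n d w I)" for g
    using rcoset_pring_eq_iff[OF ideal_I lin_comb_in_mons[OF that]]
    by (simp add: psi0_def FactRing_def)
  then show ?thesis
    unfolding ker_psi0_def a_kernel_def' by blast
qed

lemma submodule_ker_psi0: "submodule (ker_psi0 n d w I) (noether_ring n d) (F0 n d w I)"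
  unfolding F0_def
proof (rule submodule_free_moduleI)
  show "ker_psi0 n d w I \<subseteq> carrier (free_module (noether_ring n d) (B0 n d w I))"
    by (auto simp: ker_psi0_eq F0_def)
  show "0 \<in> ker_psi0 n d w I"
    using I_simps(2) by (simp add: ker_psi0_eq lin_comb_def)
  show "x + y \<in> ker_psi0 n d w I" if "x \<in> ker_psi0 n d w I" "y \<in> ker_psi0 n d w I" for x y
    using that F0_closed(1)[of x y] I_simps(3) unfolding ker_psi0_eq by (simp add: lin_comb_add)
next
  fix a :: "'k mpol" and x assume a: "keys a \<subseteq> mons T" and x: "x \<in> ker_psi0 n d w I"
  let ?ax = "a \<odot>\<^bsub>free_module (noether_ring n d) (B0 n d w I)\<^esub> x"
  have "keys a \<subseteq> mons {1..n}"
    using a mons_tail by auto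
  then have "lin_comb ?ax \<in> I"
    using x I_simps(5) by (simp add: lin_comb_smult ker_psi0_eq)
  moreover have "keys ?ax \<subseteq> B0 n d w I"
    using x by (intro order_trans[OF keys_smult_free_module]) (simp add: ker_psi0_eq)
  then have "?ax \<in> carrier (F0 n d w I)"
    using x keys_mult_mons[OF a] by (simp add: ker_psi0_eq)
  ultimately show "?ax \<in> ker_psi0 n d w I"
    by (simp add: ker_psi0_eq)
qed

lemma mod_init_term_eq:
  assumes g: "g \<in> carrier (F0 n d w I)" and g0: "g \<noteq> 0"
  obtains M u where "(M, u) \<in> mod_keys g" "lmon w (lin_comb g) = u + M" "lin_comb g \<noteq> 0"
    "mod_lmon (schreyer_like w) g = (M, u)"
    "mod_lcoeff (schreyer_like w) g = lcoeff w (lin_comb g)"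
    "mod_init_term (schreyer_like w) g =
      Poly_Mapping.single u (Poly_Mapping.single M (lcoeff w (lin_comb g)))"
proof -
  have "lin_comb g \<noteq> 0"
    using lin_comb_inj[OF g zero_in_F0] g0 by (auto simp: lin_comb_def)
  then have "lmon w (lin_comb g) \<in> (\<lambda>(M, u). u + M) ` mod_keys g"
    using lmon_in_keys keys_lin_comb_F0[OF g] by blast
  then obtain M u where Mu: "(M, u) \<in> mod_keys g" "lmon w (lin_comb g) = u + M"
    by auto
  have lm: "mod_lmon (schreyer_like w) g = (M, u)"
    unfolding mod_lmon_def
  proof (rule greatest_by_eqI[OF Mu(1)])
    fix m' assume m': "m' \<in> mod_keys g" "m' \<noteq> (M, u)"
    obtain M' v where v: "m' = (M', v)"
      by fastforce
    have "v + M' \<in> keys (lin_comb g)"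
      unfolding keys_lin_comb_F0[OF g] using m'(1) v by force
    then have "wle w (v + M') (u + M)"
      using wle_lmon[OF \<open>lin_comb g \<noteq> 0\<close>, of _ w] Mu(2) by metis
    \<comment> \<open>Distinct module monomials of \<open>g\<close> cannot tie in the pulled-back
      order, by uniqueness of the splitting.\<close>
    moreover have "v + M' \<noteq> u + M"
      using mons_split_unique[of v "{1..n}" T u M' M] mod_keys_F0[OF g, of M u]
        mod_keys_F0[OF g, of M' v] Mu(1) m' v by auto
    ultimately show "schreyer_like w (M, u) m'"
      by (auto simp: schreyer_like_def v wle_iff)
  next
    fix m' assume "schreyer_like w (M, u) m'"
    then show "\<not> schreyer_like w m' (M, u)"
      using wrevlex_asym by (auto simp: schreyer_like_def split: prod.splits)
  qed
  have lc: "mod_lcoeff (schreyer_like w) g = lcoeff w (lin_comb g)"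
    using lookup_lin_comb_F0[OF g, of u M] mod_keys_F0[OF g Mu(1)]
    by (simp add: mod_lcoeff_def lm lcoeff_def Mu(2))
  show thesis
    by (rule that[OF Mu \<open>lin_comb g \<noteq> 0\<close> lm lc]) (simp add: mod_init_term_def lm lc)
qed

text \<open>The leading monomial of zero is unspecified, but the coefficient found there is zero in
  any case.\<close>

lemma mod_init_term_zero [simp]: "mod_init_term gt (0 :: 'k fmod) = 0"
  by (simp add: mod_init_term_def mod_lcoeff_def split: prod.splits)

text \<open>The elements whose monomials are all divisible by leading monomials of \<open>K\<close>
  in the same component form a submodule. It contains the initial terms of \<open>K\<close>, hence
  all that they generate.\<close>

lemma monomial_in_init_submoduleD:
  assumes K: "K \<subseteq> carrier (F0 n d w I)"
    and mem: "Poly_Mapping.single u (xmon M) \<in>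
      gen_submodule (noether_ring n d) (F0 n d w I) (mod_init_term (schreyer_like w) ` K)"
  shows "\<exists>h\<in>K. h \<noteq> 0 \<and> (\<exists>M'. mod_lmon (schreyer_like w) h = (M', u) \<and> mon_dvd M' M)"
proof -
  define P where "P = mod_lmon (schreyer_like w) ` (K - {0})"
  let ?N = "{g. g \<in> carrier (F0 n d w I) \<and>
    (\<forall>(M, u)\<in>mod_keys g. \<exists>M'. (M', u) \<in> P \<and> mon_dvd M' M)}"
  have "submodule ?N (noether_ring n d) (F0 n d w I)"
    unfolding F0_def by (rule submodule_mod_monomials)
  moreover have "mod_init_term (schreyer_like w) ` K \<subseteq> ?N"
  proof (rule image_subsetI)
    fix h assume h: "h \<in> K"
    show "mod_init_term (schreyer_like w) h \<in> ?N"
    proof (cases "h = 0")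
      case True
      then show ?thesis
        by (simp add: mod_keys_def)
    next
      case False
      have "h \<in> carrier (F0 n d w I)"
        using h K by blast
      then obtain M' v where v: "(M', v) \<in> mod_keys h" "lin_comb h \<noteq> 0"
        "mod_lmon (schreyer_like w) h = (M', v)"
        "mod_init_term (schreyer_like w) h =
          Poly_Mapping.single v (Poly_Mapping.single M' (lcoeff w (lin_comb h)))"
        using False by (rule mod_init_term_eq)
      have "(M', v) \<in> P"
        using v(3) h False by (force simp: P_def)
      have "v \<in> B0 n d w I" "M' \<in> mons T"
        using mod_keys_F0[OF \<open>h \<in> carrier (F0 n d w I)\<close> v(1)] by (auto simp: B0_eq)
      then have "mod_init_term (schreyer_like w) h \<in> carrier (F0 n d w I)"
        unfolding v(4) by (intro single_in_F0) auto
      moreover have "mod_keys (mod_init_term (schreyer_like w) h) \<subseteq> {(M', v)}"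
        by (auto simp: v(4) mod_keys_single)
      moreover have "\<exists>M''. (M'', v) \<in> P \<and> mon_dvd M'' M'"
        using \<open>(M', v) \<in> P\<close> by (intro exI[of _ M']) simp
      ultimately show ?thesis
        by blast
    qed
  qed
  ultimately have "gen_submodule (noether_ring n d) (F0 n d w I) (mod_init_term (schreyer_like w) ` K) \<subseteq> ?N"
    by (rule gen_submodule_least)
  then have "Poly_Mapping.single u (xmon M) \<in> ?N"
    using mem by (rule subsetD)
  then obtain M' where M': "(M', u) \<in> P" "mon_dvd M' M"
    by (auto simp: mod_keys_single)
  from M'(1) obtain h where lm: "(M', u) = mod_lmon (schreyer_like w) h" and h: "h \<in> K - {0}"
    unfolding P_def by (rule imageE)
  show ?thesis
    using h M'(2) lm[symmetric] by (intro bexI[of _ h] conjI exI[of _ M']) auto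
qed

section \<open>The elements of the Groebner basis\<close>

text \<open>For \<open>u\<close> in the polynomial ring, these are the exponents of the monomials in
  I_u.\<close>

definition colon_mons :: "mon \<Rightarrow> mon set" where
  "colon_mons u = {M \<in> mons T. u + M \<in> L}"

lemma G_u_eq:
  assumes "u \<in> mons {1..n}"
  shows "G_u n d w I u = min_elems (colon_mons u)"
  unfolding G_u_def
proof (rule min_mon_gens_eq)
  show "colon_mons u \<subseteq> mons T"
    by (auto simp: colon_mons_def)
  have "keys (f * xmon u) = (\<lambda>m. u + m) ` keys f" for f :: "'k mpol"
    by (simp add: xmon_def keys_mult_single add.commute)
  then show "I_u n d w I u = {p. keys p \<subseteq> colon_mons u}"
    using mons_tail by (auto simp: I_u_def init_ideal_eq colon_mons_def)
  show "m \<in> colon_mons u" if "s \<in> colon_mons u" "mon_dvd s m" "m \<in> mons T" for s m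
  proof -
    have "mon_dvd (u + s) (u + m)"
      using that(2) by (simp add: mon_dvd_iff lookup_add)
    then show ?thesis
      using that assms mons_tail lead_mons_dvd_closed[of "u + s" "u + m"]
      by (auto simp: colon_mons_def)
  qed
qed

lemma chi_xmon:
  assumes "u \<in> mons ({1..n} - T)" "M \<in> mons T"
  shows "chi n d (xmon (u + M) :: 'k mpol) = xmon u"
proof -
  have prod_xvar: "(\<Prod>i\<in>S. xvar i ^ lookup u i :: 'k mpol) = xmon (\<Sum>i\<in>S. Poly_Mapping.single i (lookup u i))"
    if "finite S" for S
    using that by (induction S) (auto simp: xvar_power xmon_add, simp add: xmon_def)
  have "chi n d (xmon (u + M) :: 'k mpol) =
      (\<Prod>i\<in>keys u \<union> keys M. (if i \<in> T then 1 else xvar i) ^ lookup (u + M) i)"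
    by (simp add: chi_def poly_subst_def lookup_xmon single_one)
  also have "\<dots> = (\<Prod>i\<in>keys u. xvar i ^ lookup u i)"
  proof (rule prod.mono_neutral_cong_right)
    show "\<forall>i\<in>keys u \<union> keys M - keys u. (if i \<in> T then 1 else xvar i :: 'k mpol) ^ lookup (u + M) i = 1"
      using assms by (auto simp: mons_def)
    fix i assume "i \<in> keys u"
    then have "i \<notin> T"
      using assms(1) by (auto simp: mons_def)
    moreover from this have "lookup M i = 0"
      using assms(2) by (auto simp: mons_def in_keys_iff)
    ultimately show "(if i \<in> T then 1 else xvar i :: 'k mpol) ^ lookup (u + M) i = xvar i ^ lookup u i"
      by (simp add: lookup_add)
  qed auto
  also have "\<dots> = xmon u"
    by (simp add: prod_xvar sum_single_lookup)
  finally show ?thesis .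
qed

text \<open>If \<open>M\<close> is an exponent from I_u, then \<open>u + M\<close> is an exponent of
  in(I) and \<open>chi\<close> sends it to \<open>u\<close>, so \<open>u\<close> lies in J.\<close>

lemma B1'_eq: "B1' n d w I = {u + M | u M. u \<in> B0 n d w I \<and> M \<in> min_elems (colon_mons u)}"
proof -
  have "xmon u \<in> J_ideal n d w I" if "u \<in> B0 n d w I" "M \<in> min_elems (colon_mons u)" for u M
  proof -
    have "M \<in> mons T" "u + M \<in> L"
      using that(2) min_elems_subset by (auto simp: colon_mons_def)
    then have "chi n d (xmon (u + M) :: 'k mpol) = xmon u" "(xmon (u + M) :: 'k mpol) \<in> init_ideal n w I"
      using that(1) chi_xmon by (auto simp: B0_eq init_ideal_eq)
    then have "xmon u \<in> chi n d ` init_ideal n w I"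
      by (metis imageI)
    then show ?thesis
      unfolding J_ideal_def genideal_def by blast
  qed
  moreover have "G_u n d w I u = min_elems (colon_mons u)" if "u \<in> B0 n d w I" for u
    using that mons_head by (intro G_u_eq) (auto simp: B0_eq)
  ultimately show ?thesis
    unfolding B1'_def by blast
qed

text \<open>Once the descriptions in \<open>h_elem\<close> are evaluated, its image under
  \<open>lin_comb\<close> is \<open>gb_elem (u + M)\<close>. Leading data then transfer from that
  polynomial, and the splitting of \<open>u + M\<close> recovers \<open>M\<close> and
  \<open>u\<close>.\<close>

lemma h_elem_props:
  assumes u: "u \<in> B0 n d w I" and M: "M \<in> min_elems (colon_mons u)"
  shows "h_elem n d w I (u + M) \<in> ker_psi0 n d w I"
    and "lin_comb (h_elem n d w I (u + M)) = gb_elem (u + M)"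
    and "mod_lmon (schreyer_like w) (h_elem n d w I (u + M)) = (M, u)"
    and "mod_lcoeff (schreyer_like w) (h_elem n d w I (u + M)) = 1"
    and "mod_init_term (schreyer_like w) (h_elem n d w I (u + M)) = Poly_Mapping.single u (xmon M)"
proof -
  let ?h = "h_elem n d w I (u + M)"
  have MT: "M \<in> mons T" and uML: "u + M \<in> L"
    using M min_elems_subset by (auto simp: colon_mons_def)
  have uH: "u \<in> mons ({1..n} - T)"
    using u by (simp add: B0_eq)
  have uM: "u + M \<in> mons {1..n}"
    using uML lead_mons_subset by blast
  have the_u: "(THE u'. (xmon u' :: 'k mpol) = chi n d (xmon (u + M))) = u"
    by (simp add: chi_xmon[OF uH MT])
  have the_M: "(THE M'. M' \<in> G_u n d w I u \<and> u + M = u + M') = M"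
    using M G_u_eq[OF mons_head[OF uH]] by (intro the_equality) auto
  have rem: "remainder n w (reduced_gb n w I) (xmon (u + M)) = nf (xmon (u + M))"
    using uM by (intro remainder_reduced_gb) simp
  obtain f where f: "f \<in> carrier (F0 n d w I)" "lin_comb f = nf (xmon (u + M))"
    using ex_lin_comb_eq[OF keys_nf[of "xmon (u + M)"]] uM by auto
  have the_f: "(THE f. f \<in> carrier (F0 n d w I) \<and> lin_comb f = nf (xmon (u + M))) = f"
    by (rule the_equality) (use f lin_comb_inj in auto)
  have h: "?h = Poly_Mapping.single u (xmon M) - f"
    unfolding h_elem_def Let_def the_u the_M rem the_f ..
  have hF: "?h \<in> carrier (F0 n d w I)"
    unfolding h by (rule F0_closed(2)[OF single_in_F0[OF u] f(1)]) (simp add: MT)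
  show lin: "lin_comb ?h = gb_elem (u + M)"
    by (simp add: h lin_comb_minus lin_comb_single f(2) gb_elem_def xmon_add mult.commute)
  show "?h \<in> ker_psi0 n d w I"
    using hF lin gb_elem_in_ideal[OF uML] by (simp add: ker_psi0_eq del: carrier_F0)
  have "?h \<noteq> 0"
    using lin lcoeff_gb_elem[OF uML] by (auto simp: lin_comb_def lcoeff_def)
  with hF obtain M' u' where *: "(M', u') \<in> mod_keys ?h" "lmon w (lin_comb ?h) = u' + M'"
    "mod_lmon (schreyer_like w) ?h = (M', u')"
    "mod_lcoeff (schreyer_like w) ?h = lcoeff w (lin_comb ?h)"
    "mod_init_term (schreyer_like w) ?h =
      Poly_Mapping.single u' (Poly_Mapping.single M' (lcoeff w (lin_comb ?h)))"
    by (rule mod_init_term_eq)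
  have "u + M = u' + M'"
    using *(2) by (simp add: lin lmon_gb_elem[OF uML])
  then have eq: "u' = u" "M' = M"
    using mons_split_unique[OF uH _ MT] mod_keys_F0[OF hF *(1)] by blast+
  show "mod_lmon (schreyer_like w) ?h = (M, u)" "mod_lcoeff (schreyer_like w) ?h = 1"
    "mod_init_term (schreyer_like w) ?h = Poly_Mapping.single u (xmon M)"
    using *(3-5) by (simp_all add: eq lin lcoeff_gb_elem[OF uML] xmon_def)
qed

lemma is_reduced_mod_gb_h_elem:
  assumes hom: "homogeneous_set w I"
  shows "is_reduced_mod_gb (noether_ring n d) (F0 n d w I) (schreyer_like w)
    (ker_psi0 n d w I) (h_elem n d w I ` B1' n d w I)"
proof -
  let ?A = "noether_ring n d :: 'k mpol ring" and ?F = "F0 n d w I" and ?N = "ker_psi0 n d w I"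
  let ?H = "h_elem n d w I ` B1' n d w I" and ?in = "mod_init_term (schreyer_like w)"
  have H_cases: "\<exists>u M. h = h_elem n d w I (u + M) \<and> u \<in> B0 n d w I \<and> M \<in> min_elems (colon_mons u)"
    if "h \<in> ?H" for h
  proof -
    obtain \<alpha> where "h = h_elem n d w I \<alpha>" "\<alpha> \<in> B1' n d w I"
      using \<open>h \<in> ?H\<close> by (rule imageE)
    then show ?thesis
      unfolding B1'_eq by blast
  qed
  have H_intro: "h_elem n d w I (u + M) \<in> ?H" if "u \<in> B0 n d w I" "M \<in> min_elems (colon_mons u)" for u M
  proof (rule imageI)
    show "u + M \<in> B1' n d w I"
      unfolding B1'_eq using that by blast
  qed
  have HN: "?H \<subseteq> ?N"
  proof
    fix h assume "h \<in> ?H"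
    from H_cases[OF this] obtain u M where "h = h_elem n d w I (u + M)"
      and uM: "u \<in> B0 n d w I" "M \<in> min_elems (colon_mons u)"
      by (elim exE conjE)
    then show "h \<in> ?N"
      using h_elem_props(1)[OF uM] by simp
  qed
  \<comment> \<open>Noether normalization bounds the choices of \<open>u\<close>, and Dickson's
    lemma in the variables of A bounds the choices of \<open>M\<close> for each
    \<open>u\<close>.\<close>
  have "finite (\<Union>u\<in>B0 n d w I. (\<lambda>M. u + M) ` min_elems (colon_mons u))"
  proof (intro finite_UN_I finite_B0[OF hom] finite_imageI)
    show "finite (min_elems (colon_mons u))" for u
      by (rule finite_min_elems[of T]) (auto simp: tail_vars_def colon_mons_def)
  qed
  then have "finite (B1' n d w I)"
    by (rule rev_finite_subset) (auto simp: B1'_eq)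
  then have fin: "finite ?H"
    by simp
  have gen: "gen_submodule ?A ?F (?in ` ?H) = gen_submodule ?A ?F (?in ` ?N)"
  proof
    show "gen_submodule ?A ?F (?in ` ?H) \<subseteq> gen_submodule ?A ?F (?in ` ?N)"
      using HN by (intro gen_submodule_mono image_mono)
    have "?in g \<in> Q" if Q: "submodule Q ?A ?F" "?in ` ?H \<subseteq> Q" and g: "g \<in> ?N" for Q g
    proof -
      interpret submodule Q ?A ?F by fact
      show ?thesis
      proof (cases "g = 0")
        case True
        then show ?thesis
          using one_closed by (simp add: F0_def)
      next
        case False
        have gF: "g \<in> carrier ?F" and gI: "lin_comb g \<in> I"
          using g by (simp_all add: ker_psi0_eq del: carrier_F0)
        obtain M u where Mu: "(M, u) \<in> mod_keys g" "lmon w (lin_comb g) = u + M" "lin_comb g \<noteq> 0"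
          "?in g = Poly_Mapping.single u (Poly_Mapping.single M (lcoeff w (lin_comb g)))"
          using mod_init_term_eq[OF gF False] by metis
        have u: "u \<in> B0 n d w I" and MT: "M \<in> mons T"
          using mod_keys_F0[OF gF Mu(1)] by (auto simp: B0_eq)
        have "lmon w (lin_comb g) \<in> L"
          unfolding lead_mons_def using gI Mu(3) by blast
        then have "M \<in> colon_mons u"
          using MT by (simp add: colon_mons_def Mu(2))
        then obtain M' where M': "M' \<in> min_elems (colon_mons u)" "mon_dvd M' M"
          using ex_min_elem_dvd by blast
        then obtain c where c: "M = M' + c"
          by (auto simp: mon_dvd_def)
        \<comment> \<open>The generators are monic, so the cofactor \<open>c\<close> must carry the
          leading coefficient of \<open>g\<close>.\<close>
        let ?a = "Poly_Mapping.single c (lcoeff w (lin_comb g))"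
        have "Poly_Mapping.single u (xmon M') \<in> Q"
          using H_intro[OF u M'(1)] Q(2) h_elem_props(5)[OF u M'(1)] by (metis imageI subsetD)
        moreover have "?a \<in> carrier ?A"
          using MT by (auto simp: c)
        ultimately have "?a \<odot>\<^bsub>?F\<^esub> Poly_Mapping.single u (xmon M') \<in> Q"
          by (intro smult_closed)
        also have "?a \<odot>\<^bsub>?F\<^esub> Poly_Mapping.single u (xmon M') = ?in g"
          by (rule poly_mapping_eqI)
            (simp add: F0_def Mu(4) lookup_single when_def xmon_def mult_single c add.commute)
        finally show ?thesis .
      qed
    qed
    then show "gen_submodule ?A ?F (?in ` ?N) \<subseteq> gen_submodule ?A ?F (?in ` ?H)"
      unfolding gen_submodule_def by blast
  qed
  have monic: "mod_lcoeff (schreyer_like w) h = 1" if "h \<in> ?H" for h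
  proof -
    from H_cases[OF that] obtain u M where "h = h_elem n d w I (u + M)"
      and uM: "u \<in> B0 n d w I" "M \<in> min_elems (colon_mons u)"
      by (elim exE conjE)
    then show ?thesis
      using h_elem_props(4)[OF uM] by simp
  qed
  have red: "Poly_Mapping.single v (xmon M1) \<notin> gen_submodule ?A ?F (?in ` (?H - {h}))"
    if h: "h \<in> ?H" and key: "(M1, v) \<in> mod_keys h" for h M1 v
  proof
    assume *: "Poly_Mapping.single v (xmon M1) \<in> gen_submodule ?A ?F (?in ` (?H - {h}))"
    obtain u M where uM: "h = h_elem n d w I (u + M)" "u \<in> B0 n d w I" "M \<in> min_elems (colon_mons u)"
      using H_cases[OF h] by (elim exE conjE)
    have uML: "u + M \<in> L" "M \<in> mons T"
      using uM(3) min_elems_subset by (auto simp: colon_mons_def)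
    have "?H - {h} \<subseteq> carrier ?F"
      using HN by (auto simp: ker_psi0_eq simp del: carrier_F0)
    then obtain h' M' where h': "h' \<in> ?H" "h' \<noteq> h" "mod_lmon (schreyer_like w) h' = (M', v)" "mon_dvd M' M1"
      using monomial_in_init_submoduleD[OF _ *] by blast
    obtain u' M'' where u': "h' = h_elem n d w I (u' + M'')" "u' \<in> B0 n d w I" "M'' \<in> min_elems (colon_mons u')"
      using H_cases[OF h'(1)] by (elim exE conjE)
    then have eq: "u' = v" "M'' = M'"
      using h_elem_props(3)[OF u'(2,3)] h'(3) by auto
    have vM': "v + M' \<in> L" "M' \<in> mons T"
      using u'(3) min_elems_subset by (auto simp: colon_mons_def eq)
    have hF: "h \<in> carrier ?F"
      using h HN by (auto simp: ker_psi0_eq simp del: carrier_F0)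
    have v: "v \<in> mons ({1..n} - T)" "M1 \<in> mons T"
      using mod_keys_F0[OF hF key] by auto
    have "mon_dvd (v + M') (v + M1)"
      using h'(4) by (simp add: mon_dvd_iff lookup_add)
    \<comment> \<open>Divisibility by the initial term of \<open>h'\<close> puts
      \<open>v + M1\<close> into \<open>L\<close>, whereas \<open>gb_elem (u + M)\<close> has only
      \<open>u + M\<close> there. The offending monomial is thus the leading one of
      \<open>h\<close>.\<close>
    then have "v + M1 \<in> L"
      by (rule lead_mons_dvd_closed[OF vM'(1)]) (use mons_head[OF v(1)] mons_tail[OF v(2)] in simp)
    moreover have "v + M1 \<in> keys (gb_elem (u + M))"
      using keys_lin_comb_F0[OF hF] key h_elem_props(2)[OF uM(2,3)] uM(1) by force
    moreover have "keys (nf (xmon (u + M))) \<subseteq> mons {1..n} - L"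
      using uML(1) lead_mons_subset by (intro keys_nf) auto
    ultimately have "v + M1 = u + M"
      using keys_gb_elem[OF uML(1)] by blast
    then have "v = u \<and> M1 = M"
      using mons_split_unique[OF v(1) _ v(2) uML(2)] uM(2) by (auto simp: B0_eq)
    \<comment> \<open>Both are minimal generators for the same \<open>u\<close> and one divides the
      other.\<close>
    then have "M' = M"
      using u'(3) h'(4) uM(3) by (auto simp: eq min_elems_def)
    with \<open>v = u \<and> M1 = M\<close> have "h' = h"
      by (simp add: u'(1) uM(1) eq)
    with h'(2) show False ..
  qed
  show ?thesis
    unfolding is_reduced_mod_gb_def
  proof (intro conjI ballI)
    fix h p assume h: "h \<in> ?H" and p: "p \<in> mod_keys h"
    obtain M1 v where "p = (M1, v)"
      by (rule prod.exhaust)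
    with red[OF h] p show "case p of (M1, v) \<Rightarrow> Poly_Mapping.single v (xmon M1) \<notin>
        gen_submodule ?A ?F (?in ` (?H - {h}))"
      by simp
  qed (fact fin HN gen monic)+
qed

end

theorem theorem1p7:
  fixes n d :: nat
    and w :: "nat \<Rightarrow> nat"
    and I :: "('k::field) mpol set"
  assumes weights: "\<forall>i\<in>{1..n}. 0 < w i"
    and ideal: "ideal I (pring {1..n})"
    and homogeneous: "homogeneous_set w I"
    and dim: "krull_dim (pring {1..n} Quot I) = ereal (real d)"
    and noether: "is_noether_normalization (pring {1..n}) I (noether_ring n d)"
  shows "submodule (ker_psi0 n d w I) (noether_ring n d) (F0 n d w I) \<and>
         is_reduced_mod_gb (noether_ring n d) (F0 n d w I) (schreyer_like w)
           (ker_psi0 n d w I) (h_elem n d w I ` B1' n d w I)"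
proof -
  interpret noether_setting n w I d
    using weights ideal noether
    by (intro noether_setting.intro weighted_ideal.intro noether_setting_axioms.intro)
  show ?thesis
    using submodule_ker_psi0 is_reduced_mod_gb_h_elem[OF homogeneous] by blast
qed

end
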